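(* Let $C\subset\mathbb{R}^2$ be a convex curve. Then: (i) the Helly number of the family of all translates of $C$ is $\le 6$; (ii) if $C$ is strictly convex, then this Helly number is $\le 4$; (iii) if $C$ is strictly convex, every 3 sets in a family $\mathcal{C}$ of translates of $C$ have a point in common, and $\sharp\mathcal{C}\ge 5$, then the whole family $\mathcal{C}$ has nonempty intersection; moreover, the number 5 can be replaced by a smaller one for no bounded (strictly convex) curve $C$; (iv) if $C$ is strictly convex and unbounded, then the Helly number of the family of all translates of $C$ is $3$.
   Context: A convex curve is the boundary $C=\partial B$ of a proper convex subset $B$ of the Euclidean plane $\mathbb{R}^2$. A strictly convex curve is a convex curve containing no line segment. A translate of $C$ is any set of the form $C+v$ with $v\in\mathbb{R}^2$. The Helly number of a family $\mathcal{F}$ of sets is the minimal number $\chi$ with the following property: for every subfamily $F\subset\mathcal{F}$, if every subfamily $F_0\subset F$ with $\sharp F_0\le\chi$ has nonempty intersection, then the whole $F$ has nonempty intersection. Here $\sharp$ denotes cardinality.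
   Formalization: In (i), if C contains a ray but no line, only finite subfamilies F are tested (for infinite F the bound fails, e.g. translates of the graph of |x| by (n,n)); in (iii), the claim that 5 cannot be made smaller assumes C has two distinct points (it fails for a single point). *)

theory Defs
  imports "HOL-Analysis.Analysis"
begin

(* "Proper" means different from the whole plane; degenerate sets B (empty, a point, a segment,
   a ray, a line) are admitted. *)
definition convex_curve :: "(real^2) set \<Rightarrow> bool" where
  "convex_curve C \<longleftrightarrow> (\<exists>B. convex B \<and> B \<noteq> UNIV \<and> C = frontier B)"

definition strictly_convex_curve :: "(real^2) set \<Rightarrow> bool" where
  "strictly_convex_curve C \<longleftrightarrow>
     convex_curve C \<and> (\<forall>x y. x \<noteq> y \<longrightarrow> \<not> closed_segment x y \<subseteq> C)"

definition translates :: "(real^2) set \<Rightarrow> (real^2) set set" where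
  "translates C = {(+) v ` C | v. True}"

(* The empty subfamily has intersection UNIV, hence nonempty. *)
definition helly_property :: "'a set set \<Rightarrow> nat \<Rightarrow> bool" where
  "helly_property \<F> n \<longleftrightarrow>
     (\<forall>F\<subseteq>\<F>. (\<forall>G\<subseteq>F. finite G \<and> card G \<le> n \<longrightarrow> \<Inter>G \<noteq> {}) \<longrightarrow> \<Inter>F \<noteq> {})"

(* The value is \<infinity> if no n has the property; otherwise the infimum is attained. *)
definition helly_number :: "'a set set \<Rightarrow> enat" where
  "helly_number \<F> = Inf {enat n | n. helly_property \<F> n}"

(* The variant testing finite subfamilies F only.  It is needed because the unrestricted Helly
   number can be infinite for unbounded curves containing a ray: if C is the graph of the absolute
   value function, then any finitely many of the translates C + (n,n), n a natural number, have a
   common point, but all of them together have none. *)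
definition finite_helly_property :: "'a set set \<Rightarrow> nat \<Rightarrow> bool" where
  "finite_helly_property \<F> n \<longleftrightarrow>
     (\<forall>F\<subseteq>\<F>. finite F \<longrightarrow> (\<forall>G\<subseteq>F. card G \<le> n \<longrightarrow> \<Inter>G \<noteq> {}) \<longrightarrow> \<Inter>F \<noteq> {})"

definition finite_helly_number :: "'a set set \<Rightarrow> enat" where
  "finite_helly_number \<F> = Inf {enat n | n. finite_helly_property \<F> n}"

definition contains_ray :: "(real^2) set \<Rightarrow> bool" where
  "contains_ray C \<longleftrightarrow> (\<exists>a d. d \<noteq> 0 \<and> (\<forall>t\<ge>0. a + t *\<^sub>R d \<in> C))"

definition contains_line :: "(real^2) set \<Rightarrow> bool" where
  "contains_line C \<longleftrightarrow> (\<exists>a d. d \<noteq> 0 \<and> (\<forall>t. a + t *\<^sub>R d \<in> C))"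

(* Families may be infinite; an infinite family has at least k members. *)
definition triples_suffice :: "(real^2) set \<Rightarrow> nat \<Rightarrow> bool" where
  "triples_suffice C k \<longleftrightarrow>
     (\<forall>F\<subseteq>translates C.
        (\<forall>G\<subseteq>F. card G = 3 \<longrightarrow> \<Inter>G \<noteq> {}) \<and> (infinite F \<or> k \<le> card F) \<longrightarrow> \<Inter>F \<noteq> {})"

end

theory Submission
  imports Defs
begin

text \<open>Let \<open>K\<close> be closed and convex with \<open>C = frontier K\<close>. The points of \<open>C \<inter> (C + v)\<close> are the ends of the
  chords of \<open>K\<close> that are translates of \<open>[0, -v]\<close>, together with parts of the edges parallel to \<open>v\<close>. Since the
  chord length is concave, \<open>C \<inter> (C + v)\<close> is either a convex subset of a line or the union of two
  convex subsets of lines parallel to \<open>v\<close>. A further translate cuts such a segment in a convex set or in at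
  most two points, so by the Helly property of intervals two more translates suffice, in the main case, to miss each of
  the two pieces, which gives 2 + 2 + 2 = 6.

  If \<open>C\<close> is strictly convex, two translates share at most two points and, dually, two points lie on at most two
  translates; with five or more translates this already forces the common point combinatorially. If
  \<open>C\<close> is moreover unbounded, two translates share at most one point, whereas the translates by
  \<open>0, v, 2 v\<close>, where both \<open>v\<close> and \<open>2 v\<close> are chords of \<open>C\<close>, meet in pairs only.

  For bounded strictly convex \<open>C\<close>, the centroid of \<open>K\<close> bisects at least three chords, with half-chords
  \<open>m\<^sub>1, m\<^sub>2, m\<^sub>3\<close>. The four translates by \<open>(\<plusminus> m\<^sub>1 \<plusminus> m\<^sub>2 \<plusminus> m\<^sub>3) / 2\<close> with an even number of minus signs then meet in
  triples but not all together, like the four unit circles of an orthocentric system.\<close>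

section \<open>Frontiers of convex sets along lines\<close>

text \<open>If a point \<open>z\<close> of the segment were interior to \<open>K\<close>, all points
  strictly between \<open>z\<close> and either end would be interior as well, and \<open>x\<close>
  is \<open>z\<close> or one of these.\<close>

lemma frontier_segment_subset:
  fixes K :: "'a::euclidean_space set"
  assumes "convex K" "closed K" "x \<in> frontier K" "u \<in> K" "w \<in> K" "x \<in> open_segment u w"
  shows "closed_segment u w \<subseteq> frontier K"
proof
  fix z assume z: "z \<in> closed_segment u w"
  then have zK: "z \<in> K"
    using assms closed_segment_subset by blast
  have x: "x \<notin> interior K"
    using assms(3) by (simp add: frontier_def)
  have "z \<notin> interior K"
  proof
    assume zi: "z \<in> interior K"
    have "x = z \<or> x \<in> open_segment z u \<or> x \<in> open_segment z w"
    proof -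
      have "x \<in> closed_segment u z \<or> x \<in> closed_segment z w"
        using z assms(6) Un_closed_segment[OF z] open_closed_segment by blast
      then show ?thesis
        using assms(6) by (auto simp: open_segment_def closed_segment_commute)
    qed
    moreover have "open_segment z u \<subseteq> interior K" "open_segment z w \<subseteq> interior K"
      using in_interior_closure_convex_segment[OF \<open>convex K\<close> zi] assms closure_subset by blast+
    ultimately show False
      using x zi by blast
  qed
  then show "z \<in> frontier K"
    using zK assms(2) by (simp add: frontier_def)
qed

lemma open_segment_on_line:
  fixes a d :: "'a::real_vector"
  assumes "r < s" "s < t" "d \<noteq> 0"
  shows "a + s *\<^sub>R d \<in> open_segment (a + r *\<^sub>R d) (a + t *\<^sub>R d)"
proof -
  define u where "u = (s - r) / (t - r)"
  have "u * (t - r) = s - r"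
    using assms by (simp add: u_def)
  then have u3: "s = (1 - u) * r + u * t"
    by (simp add: algebra_simps)
  have u: "0 < u" "u < 1"
    using assms by (auto simp: u_def)
  have "a + s *\<^sub>R d = (1 - u) *\<^sub>R (a + r *\<^sub>R d) + u *\<^sub>R (a + t *\<^sub>R d)"
    unfolding u3 by (simp add: algebra_simps)
  then show ?thesis
    using u assms unfolding in_segment by auto
qed

text \<open>Of the three frontier points, the middle one puts the whole segment between the outer
  two on the frontier, and the parameter \<open>t\<close> lies between the outer two wherever
  \<open>s\<close> falls.\<close>

lemma frontier_line_between:
  fixes a d :: "'a::euclidean_space"
  assumes K: "convex K" "closed K" and "d \<noteq> 0" "r < t" "t < r'" "s \<noteq> r" "s \<noteq> r'"
    and "a + r *\<^sub>R d \<in> frontier K" "a + r' *\<^sub>R d \<in> frontier K" "a + s *\<^sub>R d \<in> frontier K"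
  shows "a + t *\<^sub>R d \<in> frontier K"
proof -
  have sub: "frontier K \<subseteq> K"
    using K by (simp add: frontier_subset_closed)
  have *: "a + t *\<^sub>R d \<in> frontier K"
    if "p \<le> t" "t \<le> q" "p < m" "m < q" "a + p *\<^sub>R d \<in> frontier K" "a + q *\<^sub>R d \<in> frontier K"
      "a + m *\<^sub>R d \<in> frontier K" for p q m
  proof -
    have "a + t *\<^sub>R d \<in> closed_segment (a + p *\<^sub>R d) (a + q *\<^sub>R d)"
      using open_segment_on_line[of p t q d a] that \<open>d \<noteq> 0\<close> open_closed_segment
      by (cases "t = p \<or> t = q") force+
    then show ?thesis
      using frontier_segment_subset[OF K that(7)] that open_segment_on_line[of p m q d a] \<open>d \<noteq> 0\<close> sub
      by blast
  qed
  consider "s < r" | "r < s" "s < r'" | "r' < s"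
    using assms by linarith
  then show ?thesis
  proof cases
    case 1 then show ?thesis using *[of s r' r] assms by auto
  next
    case 2 then show ?thesis using *[of r r' s] assms by auto
  next
    case 3 then show ?thesis using *[of r s r'] assms by auto
  qed
qed

text \<open>An interior point of the line, joined to whichever of the two points of \<open>K\<close>
  lies beyond the parameter \<open>s\<close>, would make the point at \<open>s\<close>
  interior.\<close>

lemma frontier_line_no_interior:
  fixes a d :: "'a::euclidean_space"
  assumes K: "convex K" "closed K" and "d \<noteq> 0" "r < s" "s < t"
    and "a + r *\<^sub>R d \<in> K" "a + t *\<^sub>R d \<in> K" "a + s *\<^sub>R d \<in> frontier K"
  shows "a + c *\<^sub>R d \<notin> interior K"
proof
  assume c: "a + c *\<^sub>R d \<in> interior K"
  have s: "a + s *\<^sub>R d \<notin> interior K"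
    using assms(8) by (simp add: frontier_def)
  have seg: "open_segment (a + c *\<^sub>R d) (a + q *\<^sub>R d) \<subseteq> interior K" if "a + q *\<^sub>R d \<in> K" for q
    using in_interior_closure_convex_segment[OF K(1) c] that closure_subset by blast
  consider "c = s" | "c < s" | "s < c"
    by linarith
  then show False
  proof cases
    case 1 then show ?thesis using c s by simp
  next
    case 2 then show ?thesis
      using open_segment_on_line[of c s t d a] seg[of t] assms s by blast
  next
    case 3 then show ?thesis
      using open_segment_on_line[of r s c d a] seg[of r] assms s
      by (metis open_segment_commute subsetD)
  qed
qed

section \<open>Finite subfamilies with empty trace\<close>

text \<open>Contrapositive form of the Helly property, relative to a set \<open>S\<close>: a small
  subfamily witnesses that \<open>F\<close> has no common point in \<open>S\<close>. With
  \<open>S = UNIV\<close> the bound \<open>k\<close> is a bound for the Helly number. The costs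
  \<open>k\<close> add up when \<open>S\<close> is cut into pieces, which is how all the counting is
  done.\<close>

definition misses :: "'a set set \<Rightarrow> 'a set \<Rightarrow> nat \<Rightarrow> bool" where
  "misses F S k \<longleftrightarrow> (\<exists>G\<subseteq>F. finite G \<and> card G \<le> k \<and> S \<inter> \<Inter>G = {})"

lemma misses_mono: "misses F S k \<Longrightarrow> F \<subseteq> F' \<Longrightarrow> S' \<subseteq> S \<Longrightarrow> k \<le> k' \<Longrightarrow> misses F' S' k'"
  unfolding misses_def by (smt (verit) Int_mono disjoint_iff dual_order.trans subset_eq)

lemma misses_Un:
  assumes "misses F S k" "misses F T l"
  shows "misses F (S \<union> T) (k + l)"
proof -
  obtain G H where G: "G \<subseteq> F" "finite G" "card G \<le> k" "S \<inter> \<Inter>G = {}"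
    and H: "H \<subseteq> F" "finite H" "card H \<le> l" "T \<inter> \<Inter>H = {}"
    using assms unfolding misses_def by blast
  have "card (G \<union> H) \<le> k + l"
    using card_Un_le[of G H] G H by linarith
  moreover have "(S \<union> T) \<inter> \<Inter>(G \<union> H) = {}"
    using G H by auto
  ultimately show ?thesis
    unfolding misses_def using G H by (intro exI[of _ "G \<union> H"]) auto
qed

lemma misses_Int:
  assumes "Z \<in> F" "misses F (S \<inter> Z) k"
  shows "misses F S (Suc k)"
proof -
  obtain G where G: "G \<subseteq> F" "finite G" "card G \<le> k" "S \<inter> Z \<inter> \<Inter>G = {}"
    using assms unfolding misses_def by blast
  have "card (insert Z G) \<le> Suc k"
    using card_insert_le_m1[of "Suc k" G Z] G by simp
  moreover have "S \<inter> \<Inter>(insert Z G) = {}"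
    using G by auto
  ultimately show ?thesis
    unfolding misses_def using G assms by (intro exI[of _ "insert Z G"]) auto
qed

lemma misses_empty: "misses F {} k"
  unfolding misses_def by (intro exI[of _ "{}"]) auto

lemma misses_subsingleton:
  assumes "S \<inter> \<Inter>F = {}" "S \<subseteq> {p}"
  shows "misses F S 1"
proof (cases "S = {}")
  case True then show ?thesis by (simp add: misses_empty)
next
  case False
  then have "S = {p}" using assms by blast
  then obtain Z where "Z \<in> F" "S \<inter> Z = {}" using assms by auto
  then show ?thesis using misses_Int[of Z F S 0] misses_empty[of F 0] by simp
qed

lemma misses_doubleton:
  assumes "S \<inter> \<Inter>F = {}" "S \<subseteq> {p, q}"
  shows "misses F S 2"
proof -
  have "misses F (S \<inter> {x}) 1" for x
    by (rule misses_subsingleton[where p = x]) (use assms(1) in auto)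
  from misses_Un[OF this[of p] this[of q]] show ?thesis
    by (rule misses_mono) (use assms in auto)
qed

text \<open>Helly's theorem in dimension one, applied to the parameter sets of the traces
  \<open>S \<inter> Z\<close>. Only the traces have to be convex, not the members of
  \<open>F\<close>.\<close>

lemma misses_segment_finite:
  fixes S :: "'a::euclidean_space set"
  assumes S: "S \<subseteq> {a + t *\<^sub>R d | t. True}" and cv: "\<And>Z. Z \<in> F \<Longrightarrow> convex (S \<inter> Z)"
    and "finite F" and empty: "S \<inter> \<Inter>F = {}"
  shows "misses F S 2"
proof (rule ccontr)
  assume neg: "\<not> misses F S 2"
  define T where "T Z = {t::real. a + t *\<^sub>R d \<in> S \<inter> Z}" for Z
  have convT: "convex (T Z)" if "Z \<in> F" for Z
  proof (rule convexI)
    fix x y u v :: real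
    assume *: "x \<in> T Z" "y \<in> T Z" "0 \<le> u" "0 \<le> v" "u + v = 1"
    have "u *\<^sub>R (a + x *\<^sub>R d) + v *\<^sub>R (a + y *\<^sub>R d) \<in> S \<inter> Z"
      by (rule convexD[OF cv[OF that]]) (use * in \<open>auto simp: T_def\<close>)
    moreover have "u *\<^sub>R (a + x *\<^sub>R d) + v *\<^sub>R (a + y *\<^sub>R d) = (u + v) *\<^sub>R a + (u * x + v * y) *\<^sub>R d"
      by (simp add: algebra_simps)
    ultimately show "u *\<^sub>R x + v *\<^sub>R y \<in> T Z"
      using * by (simp add: T_def)
  qed
  have pair: "T Z \<inter> T Z' \<noteq> {}" if "Z \<in> F" "Z' \<in> F" for Z Z'
  proof
    assume e: "T Z \<inter> T Z' = {}"
    have "S \<inter> \<Inter>{Z, Z'} = {}"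
      using e S by (auto simp: T_def)
    moreover have "card {Z, Z'} \<le> 2"
      by (simp add: card_insert_if)
    ultimately show False
      using neg that unfolding misses_def by (metis empty_subsetI finite.emptyI finite_insert insert_subset)
  qed
  have "\<Inter>(T ` F) \<noteq> {}"
  proof (cases "card (T ` F) \<ge> 2")
    case True
    show ?thesis
    proof (rule Helly)
      show "card (T ` F) \<ge> DIM(real) + 1" using True by simp
      show "\<forall>s\<in>T ` F. convex s" using convT by auto
      fix t assume t: "t \<subseteq> T ` F" "card t = DIM(real) + 1"
      then obtain A B where "t = {A, B}" by (auto simp: card_2_iff numeral_2_eq_2[symmetric])
      then show "\<Inter>t \<noteq> {}" using t pair by auto
    qed
  next
    \<comment> \<open>Helly's theorem asks for at least two sets. Here all traces give one and the
      same parameter set, which is nonempty because \<open>pair\<close> also applies to a member and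
      itself.\<close>
    case False
    have "S \<noteq> {}" using neg misses_empty by metis
    moreover from this have "F \<noteq> {}" using empty by auto
    then obtain Z where Z: "Z \<in> F" by auto
    have "card (T ` F) = 1"
      using False Z \<open>finite F\<close> by (metis One_nat_def Suc_1 card_0_eq finite_imageI image_is_empty less_2_cases not_le empty_iff)
    then obtain A where A: "T ` F = {A}" by (auto simp: card_1_singleton_iff)
    then have "A = T Z" using Z by auto
    then show ?thesis using A pair[OF Z Z] by auto
  qed
  then obtain t where "\<And>Z. Z \<in> F \<Longrightarrow> t \<in> T Z" by auto
  then have "F = {} \<or> a + t *\<^sub>R d \<in> S \<inter> \<Inter>F" by (auto simp: T_def)
  then have "F = {}" using empty by auto
  then show False using empty neg misses_empty by auto
qed

text \<open>Compactness of \<open>S\<close> replaces an infinite family by a finite subfamily that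
  already has empty trace.\<close>

lemma misses_segment:
  fixes S :: "'a::euclidean_space set"
  assumes S: "S \<subseteq> {a + t *\<^sub>R d | t. True}" and cv: "\<And>Z. Z \<in> F \<Longrightarrow> convex (S \<inter> Z)"
    and cl: "\<And>Z. Z \<in> F \<Longrightarrow> closed Z"
    and fin: "finite F \<or> compact S" and empty: "S \<inter> \<Inter>F = {}"
  shows "misses F S 2"
proof -
  obtain F' where F': "F' \<subseteq> F" "finite F'" "S \<inter> \<Inter>F' = {}"
    using fin compact_imp_fip[of S F] cl empty by blast
  then have "misses F' S 2"
    using misses_segment_finite[OF S, of F'] cv by blast
  then show ?thesis
    using misses_mono F'(1) by blast
qed

section \<open>Recession directions\<close>

text \<open>The direction \<open>d\<close> is a limit of unit vectors pointing from a fixed point of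
  \<open>S\<close> to points of \<open>S\<close> that run off to infinity.\<close>

lemma unbounded_convex_recession:
  fixes S :: "'a::euclidean_space set"
  assumes "convex S" "closed S" "\<not> bounded S"
  obtains d where "d \<noteq> 0" "\<And>x t. x \<in> S \<Longrightarrow> t \<ge> 0 \<Longrightarrow> x + t *\<^sub>R d \<in> S"
proof -
  obtain a where a: "a \<in> S" using assms(3) by fastforce
  have "\<exists>x\<in>S. norm (x - a) > real n" for n
  proof (rule ccontr)
    assume "\<not> ?thesis"
    then have "S \<subseteq> cball a (real n)" by (auto simp: dist_norm norm_minus_commute)
    then show False using assms(3) bounded_subset bounded_cball by blast
  qed
  then obtain X where X: "\<And>n. X n \<in> S" "\<And>n. norm (X n - a) > real n" by metis
  define u where "u n = (X n - a) /\<^sub>R norm (X n - a)" for n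
  have nz: "norm (X n - a) > 0" for n using X(2)[of n] by (meson le_less_trans of_nat_0_le_iff)
  have "\<forall>n. u n \<in> sphere 0 1"
    using nz by (simp add: u_def)
  then obtain d r where d: "d \<in> sphere 0 1" "strict_mono r" "(u \<circ> r) \<longlonglongrightarrow> d"
    using compact_sphere[of "0::'a" 1] unfolding compact_def by meson
  have inf: "filterlim (\<lambda>n. norm (X n - a)) at_top sequentially"
    by (rule filterlim_at_top_mono[OF filterlim_real_sequentially]) (simp add: X(2) less_imp_le)
  have infr: "filterlim (\<lambda>n. norm (X (r n) - a)) at_top sequentially"
    using filterlim_compose[OF inf filterlim_subseq[OF d(2)]] .
  have "x + t *\<^sub>R d \<in> S" if "x \<in> S" "t \<ge> 0" for x t
  proof -
    define c where "c n = t / norm (X (r n) - a)" for n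
    have c0: "c \<longlonglongrightarrow> 0"
      unfolding c_def using tendsto_divide_0[OF tendsto_const filterlim_at_top_imp_at_infinity[OF infr]] .
    \<comment> \<open>The weight \<open>c n\<close> tends to 0 but is chosen so that the far point
      \<open>X (r n)\<close> contributes a displacement of length exactly \<open>t\<close>. The
      points on the left lie in \<open>S\<close>, and their limit is
      \<open>x + t *\<^sub>R d\<close>.\<close>
    have eq: "(1 - c n) *\<^sub>R x + c n *\<^sub>R X (r n) = x + t *\<^sub>R (u \<circ> r) n + c n *\<^sub>R (a - x)" for n
      using nz[of "r n"] by (simp add: c_def u_def algebra_simps divide_inverse_commute)
    have "(\<lambda>n. x + t *\<^sub>R (u \<circ> r) n + c n *\<^sub>R (a - x)) \<longlonglongrightarrow> x + t *\<^sub>R d + 0 *\<^sub>R (a - x)"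
      by (intro tendsto_intros c0 d)
    moreover have "\<forall>\<^sub>F n in sequentially. x + t *\<^sub>R (u \<circ> r) n + c n *\<^sub>R (a - x) \<in> S"
    proof -
      have "\<forall>\<^sub>F n in sequentially. c n < 1"
        using order_tendstoD(2)[OF c0] by simp
      then show ?thesis
      proof eventually_elim
        case (elim n)
        have "c n \<ge> 0" using that by (simp add: c_def)
        then show ?case
          unfolding eq[symmetric] using elim X(1) that convexD[OF assms(1)] by simp
      qed
    qed
    ultimately show ?thesis
      using Lim_in_closed_set[OF assms(2)] by fastforce
  qed
  moreover have "d \<noteq> 0" using d by auto
  ultimately show ?thesis using that by blast
qed

section \<open>Intersections of two translates\<close>

lemma convex_on_lineI:
  fixes a d :: "'a::real_vector"
  assumes S: "S \<subseteq> {a + t *\<^sub>R d | t. True}" and "d \<noteq> 0"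
    and between: "\<And>r t r'. r < t \<Longrightarrow> t < r' \<Longrightarrow> a + r *\<^sub>R d \<in> S \<Longrightarrow> a + r' *\<^sub>R d \<in> S \<Longrightarrow> a + t *\<^sub>R d \<in> S"
  shows "convex S"
proof -
  have "closed_segment x y \<subseteq> S" if xy: "x \<in> S" "y \<in> S" for x y
  proof
    fix z assume "z \<in> closed_segment x y"
    then obtain u where u: "0 \<le> u" "u \<le> 1" "z = (1 - u) *\<^sub>R x + u *\<^sub>R y"
      by (auto simp: in_segment)
    obtain r r' where r: "x = a + r *\<^sub>R d" "y = a + r' *\<^sub>R d"
      using xy S by blast
    define t where "t = (1 - u) * r + u * r'"
    have z: "z = a + t *\<^sub>R d"
      unfolding u(3) r t_def by (simp add: algebra_simps)
    have "t \<in> closed_segment r r'"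
      using u by (auto simp: in_segment t_def)
    then consider "t = r" | "t = r'" | "r < t" "t < r'" | "r' < t" "t < r"
      by (auto simp: closed_segment_eq_real_ivl split: if_splits) linarith+
    then show "z \<in> S"
      using xy r z between by cases auto
  qed
  then show ?thesis
    by (simp add: convex_contains_segment)
qed

text \<open>Two points of the set, at parameters \<open>r < r'\<close>, give frontier points at
  \<open>r - 1\<close>, \<open>r\<close>, \<open>r' - 1\<close> and \<open>r'\<close>. At least
  three of these are distinct, so the frontier contains the whole stretch, which is an edge of
  \<open>K\<close>.\<close>

lemma frontier_inter_translate_line_convex:
  fixes K :: "'a::euclidean_space set"
  assumes K: "convex K" "closed K" and "v \<noteq> 0"
  shows "convex {x \<in> frontier K. x - v \<in> frontier K \<and> x \<in> {a + t *\<^sub>R v | t. True}}" (is "convex ?M")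
proof (rule convex_on_lineI[OF _ \<open>v \<noteq> 0\<close>, of _ a])
  fix r t r' :: real
  assume z: "r < t" "t < r'" and r: "a + r *\<^sub>R v \<in> ?M" "a + r' *\<^sub>R v \<in> ?M"
  have m: "a + (r - 1) *\<^sub>R v \<in> frontier K" "a + (r' - 1) *\<^sub>R v \<in> frontier K"
    using r by (simp_all add: algebra_simps)
  have "a + t *\<^sub>R v \<in> frontier K"
    by (rule frontier_line_between[OF K \<open>v \<noteq> 0\<close> z, of "r - 1"]) (use r z m in auto)
  moreover have "a + (t - 1) *\<^sub>R v \<in> frontier K"
    by (rule frontier_line_between[OF K \<open>v \<noteq> 0\<close>, of "r - 1" _ "r' - 1" "r'"])
       (use r m z in auto)
  ultimately show "a + t *\<^sub>R v \<in> ?M"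
    by (auto simp: algebra_simps)
qed auto

text \<open>A trace with more than two points has, for any two of its points, a third one; then the
  frontier contains everything between the two.\<close>

lemma frontier_inter_line:
  fixes K :: "'a::euclidean_space set"
  assumes K: "convex K" "closed K" and S: "convex S" "S \<subseteq> {a + t *\<^sub>R d | t. True}" and "d \<noteq> 0"
  obtains "convex (S \<inter> frontier K)" | p q where "S \<inter> frontier K \<subseteq> {p, q}"
proof (cases "\<exists>p q. S \<inter> frontier K \<subseteq> {p, q}")
  case False
  have "convex (S \<inter> frontier K)"
  proof (rule convex_on_lineI[OF _ \<open>d \<noteq> 0\<close>, of _ a])
    fix r t r' :: real
    assume t: "r < t" "t < r'" and r: "a + r *\<^sub>R d \<in> S \<inter> frontier K" "a + r' *\<^sub>R d \<in> S \<inter> frontier K"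
    obtain w where w: "w \<in> S \<inter> frontier K" "w \<noteq> a + r *\<^sub>R d" "w \<noteq> a + r' *\<^sub>R d"
      using False by blast
    then obtain s where s: "w = a + s *\<^sub>R d" using S(2) by blast
    have "a + t *\<^sub>R d \<in> frontier K"
      using frontier_line_between[OF K \<open>d \<noteq> 0\<close> t, of s a] r w s by auto
    moreover have "a + t *\<^sub>R d \<in> S"
      using open_segment_on_line[OF t \<open>d \<noteq> 0\<close>, of a] r S(1)
      by (meson IntD1 closed_segment_subset open_closed_segment subsetD)
    ultimately show "a + t *\<^sub>R d \<in> S \<inter> frontier K" by simp
  qed (use S in auto)
  then show ?thesis using that by blast
qed (use that in blast)

section \<open>Directions and heights in the plane\<close>

text \<open>Rotation by a quarter turn. The number \<open>rot v \<bullet> x\<close> is the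
  determinant of \<open>v\<close> and \<open>x\<close>; it serves as the height of \<open>x\<close>
  across the lines parallel to \<open>v\<close>.\<close>

definition rot :: "real^2 \<Rightarrow> real^2" where
  "rot v = vector [- v $ 2, v $ 1]"

lemma rot_inner: "rot v \<bullet> x = v $ 1 * x $ 2 - v $ 2 * x $ 1"
  by (simp add: rot_def inner_vec_def sum_2 algebra_simps)

lemma rot_inner_self: "rot v \<bullet> v = 0"
  by (simp add: rot_inner)

lemma rot_nonzero: "v \<noteq> 0 \<Longrightarrow> rot v \<noteq> 0"
  by (auto simp: rot_def vec_eq_iff forall_2)

lemma rot_eq_on_line:
  assumes "v \<noteq> 0" "rot v \<bullet> x = rot v \<bullet> y"
  shows "\<exists>t. y = x + t *\<^sub>R v"
proof -
  have e: "v $ 1 * (y $ 2 - x $ 2) = v $ 2 * (y $ 1 - x $ 1)"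
    using assms(2) by (simp add: rot_inner algebra_simps)
  consider "v $ 1 \<noteq> 0" | "v $ 2 \<noteq> 0"
    using assms(1) by (auto simp: vec_eq_iff forall_2)
  then show ?thesis
  proof cases
    case 1
    then show ?thesis
      using e by (intro exI[of _ "(y $ 1 - x $ 1) / v $ 1"]) (simp add: vec_eq_iff forall_2 field_simps)
  next
    case 2
    then show ?thesis
      using e by (intro exI[of _ "(y $ 2 - x $ 2) / v $ 2"]) (simp add: vec_eq_iff forall_2 field_simps)
  qed
qed

lemma segment_at_height:
  fixes n x y :: "'a::real_inner"
  assumes "n \<bullet> x < h" "h < n \<bullet> y"
  obtains z where "z \<in> open_segment x y" "n \<bullet> z = h"
proof -
  define u where "u = (h - n \<bullet> x) / (n \<bullet> y - n \<bullet> x)"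
  have "u * (n \<bullet> y - n \<bullet> x) = h - n \<bullet> x"
    using assms by (simp add: u_def)
  then have "n \<bullet> ((1 - u) *\<^sub>R x + u *\<^sub>R y) = h"
    by (simp add: inner_add_right algebra_simps)
  moreover have "0 < u" "u < 1"
    using assms by (auto simp: u_def)
  moreover have "x \<noteq> y"
    using assms by auto
  ultimately show ?thesis
    using that[of "(1 - u) *\<^sub>R x + u *\<^sub>R y"] by (auto simp: in_segment)
qed

text \<open>An interior point on the wrong side of the height \<open>h\<close> is joined to the one
  of \<open>x\<close>, \<open>y\<close> on the other side; the open segment stays interior and
  crosses \<open>h\<close>.\<close>

lemma interior_at_height:
  fixes K :: "'a::euclidean_space set"
  assumes "convex K" "interior K \<noteq> {}" "x \<in> K" "y \<in> K" "n \<bullet> x < h" "h < n \<bullet> y"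
  obtains c where "c \<in> interior K" "n \<bullet> c = h"
proof -
  obtain c where c: "c \<in> interior K" using assms(2) by blast
  have seg: "open_segment c z \<subseteq> interior K" if "z \<in> K" for z
    using in_interior_closure_convex_segment[OF assms(1) c] that closure_subset by blast
  consider "n \<bullet> c = h" | "n \<bullet> c < h" | "h < n \<bullet> c" by linarith
  then show ?thesis
  proof cases
    case 2
    then show ?thesis
      using segment_at_height[OF 2 assms(6)] seg[OF assms(4)] that by blast
  next
    case 3
    then show ?thesis
      using segment_at_height[OF assms(5) 3] seg[OF assms(3)] that
      by (metis open_segment_commute subsetD)
  qed (use c that in blast)
qed

text \<open>The chords of \<open>K\<close> in direction \<open>v\<close> through \<open>x\<close>, \<open>y\<close>, \<open>w\<close> have length at least that of
  \<open>v\<close>, and the middle one has exactly that length; concavity of the chord length forces collinearity.\<close>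

lemma three_heights_open_segment:
  fixes K :: "(real^2) set"
  assumes K: "convex K" "closed K" "interior K \<noteq> {}" and "v \<noteq> 0"
    and M: "x \<in> frontier K" "x - v \<in> frontier K" "y \<in> frontier K" "y - v \<in> frontier K"
      "w \<in> frontier K" "w - v \<in> frontier K"
    and h: "rot v \<bullet> x < rot v \<bullet> y" "rot v \<bullet> y < rot v \<bullet> w"
  shows "y \<in> open_segment x w"
proof -
  have sub: "frontier K \<subseteq> K"
    using K by (simp add: frontier_subset_closed)
  obtain c where c: "c \<in> interior K" "rot v \<bullet> c = rot v \<bullet> y"
    using interior_at_height[OF K(1,3) _ _ h] M sub by blast
  obtain z where z: "z \<in> open_segment x w" "rot v \<bullet> z = rot v \<bullet> y"
    using segment_at_height[OF h] by blast
  have zK: "z \<in> K"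
    using z(1) M sub K(1) by (meson closed_segment_subset open_closed_segment subsetD)
  obtain u where u: "0 < u" "u < 1" "z = (1 - u) *\<^sub>R x + u *\<^sub>R w"
    using z(1) by (auto simp: in_segment)
  have "z - v = (1 - u) *\<^sub>R (x - v) + u *\<^sub>R (w - v)"
    by (simp add: u(3) algebra_simps)
  then have zvK: "z - v \<in> K"
    using M sub u convexD[OF K(1), of "x - v" "w - v" "1 - u" u] by auto
  obtain s where s: "c = y + s *\<^sub>R v"
    using rot_eq_on_line[OF \<open>v \<noteq> 0\<close>, of y c] c by auto
  obtain r where r: "z = y + r *\<^sub>R v"
    using rot_eq_on_line[OF \<open>v \<noteq> 0\<close>, of y z] z by auto
  \<comment> \<open>If \<open>r > 0\<close>, the frontier point \<open>y\<close> lies between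
    \<open>y - v\<close> and \<open>z\<close>; if \<open>r < 0\<close>, the frontier point
    \<open>y - v\<close> lies between \<open>z - v\<close> and \<open>y\<close>. Either way the line
    through \<open>y\<close> along \<open>v\<close> has no interior point, although it contains
    \<open>c\<close>.\<close>
  have "r = 0"
  proof (rule ccontr)
    assume "r \<noteq> 0"
    then consider "r > 0" | "r < 0" by linarith
    then show False
    proof cases
      case 1
      show False
        using frontier_line_no_interior[OF K(1,2) \<open>v \<noteq> 0\<close>, of "-1" 0 r y s] 1 M sub zK r s c
        by auto
    next
      case 2
      have "y + (r - 1) *\<^sub>R v \<in> K"
        using zvK r by (simp add: algebra_simps)
      then show False
        using frontier_line_no_interior[OF K(1,2) \<open>v \<noteq> 0\<close>, of "r - 1" "-1" 0 y s] 2 M sub s c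
        by auto
    qed
  qed
  then show ?thesis using z(1) r by simp
qed

lemma open_segment_line_through:
  fixes x y w :: "'a::real_vector"
  assumes "y \<in> open_segment x w"
  shows "\<exists>t. w = x + t *\<^sub>R (y - x)" "\<exists>t. x = w + t *\<^sub>R (y - w)"
proof -
  obtain u where u: "0 < u" "u < 1" "y = (1 - u) *\<^sub>R x + u *\<^sub>R w"
    using assms by (auto simp: in_segment)
  have "y - x = u *\<^sub>R (w - x)" "y - w = (1 - u) *\<^sub>R (x - w)"
    unfolding u(3) by (simp_all add: algebra_simps)
  then have "w = x + (1 / u) *\<^sub>R (y - x)" "x = w + (1 / (1 - u)) *\<^sub>R (y - w)"
    using u by simp_all
  then show "\<exists>t. w = x + t *\<^sub>R (y - x)" "\<exists>t. x = w + t *\<^sub>R (y - w)"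
    by blast+
qed

text \<open>Every point of \<open>M\<close> at a height outside the range from \<open>x\<close> to
  \<open>w\<close> is brought onto the line \<open>x w\<close> by using \<open>y\<close> as the
  middle point of a triple. Once \<open>M\<close> is on a line, three points on it suffice to make
  both the frontier and its translate contain the stretch between any two.\<close>

lemma three_heights_collinear:
  fixes K :: "(real^2) set"
  assumes K: "convex K" "closed K" "interior K \<noteq> {}" and "v \<noteq> 0"
    and M: "M = {x \<in> frontier K. x - v \<in> frontier K}"
    and xyw: "x \<in> M" "y \<in> M" "w \<in> M"
    and h: "rot v \<bullet> x < rot v \<bullet> y" "rot v \<bullet> y < rot v \<bullet> w"
  shows "\<exists>a d. d \<noteq> 0 \<and> M \<subseteq> {a + t *\<^sub>R d | t. True}" "convex M"
proof -
  define d where "d = w - x"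
  define L where "L = {x + t *\<^sub>R d | t. True}"
  have th: "b \<in> open_segment a c" if "a \<in> M" "b \<in> M" "c \<in> M" "rot v \<bullet> a < rot v \<bullet> b" "rot v \<bullet> b < rot v \<bullet> c"
    for a b c
    using three_heights_open_segment[OF K \<open>v \<noteq> 0\<close>] that M by blast
  have "d \<noteq> 0" using h by (auto simp: d_def)
  have lin: "p + t *\<^sub>R (q - p) \<in> L" if pq: "p \<in> L" "q \<in> L" for p q t
  proof -
    obtain i j where "p = x + i *\<^sub>R d" "q = x + j *\<^sub>R d" using pq unfolding L_def by blast
    then have "p + t *\<^sub>R (q - p) = x + (i + t * (j - i)) *\<^sub>R d"
      by (simp add: algebra_simps)
    then show ?thesis unfolding L_def by blast
  qed
  have xL: "x \<in> L"
    unfolding L_def by (auto intro: exI[of _ 0])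
  have wL: "w \<in> L"
    unfolding L_def d_def by (auto intro: exI[of _ 1])
  have mid: "m \<in> L" if m: "m \<in> M" "rot v \<bullet> x < rot v \<bullet> m" "rot v \<bullet> m < rot v \<bullet> w" for m
  proof -
    obtain u where u: "m = (1 - u) *\<^sub>R x + u *\<^sub>R w"
      using th[OF xyw(1) m(1) xyw(3)] m by (auto simp: in_segment)
    show ?thesis
      unfolding L_def d_def u by (auto intro!: exI[of _ u] simp: algebra_simps)
  qed
  have yL: "y \<in> L" using mid xyw h by blast
  have "m \<in> L" if m: "m \<in> M" for m
  proof -
    consider "rot v \<bullet> x < rot v \<bullet> m" "rot v \<bullet> m < rot v \<bullet> w" | "rot v \<bullet> m \<le> rot v \<bullet> x" | "rot v \<bullet> w \<le> rot v \<bullet> m"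
      by linarith
    then show ?thesis
    proof cases
      case 1 then show ?thesis using mid m by blast
    next
      case 2
      then have "y \<in> open_segment m w" using th[OF m xyw(2,3)] h by linarith
      then show ?thesis using open_segment_line_through(2) lin[OF wL yL] by metis
    next
      case 3
      then have "y \<in> open_segment x m" using th[OF xyw(1,2) m] h by linarith
      then show ?thesis using open_segment_line_through(1) lin[OF xL yL] by metis
    qed
  qed
  then have subL: "M \<subseteq> L" by blast
  then show "\<exists>a d. d \<noteq> 0 \<and> M \<subseteq> {a + t *\<^sub>R d | t. True}"
    using \<open>d \<noteq> 0\<close> unfolding L_def by blast
  have third: "\<exists>m\<in>M. m \<noteq> p \<and> m \<noteq> q" for p q
    using xyw h by (metis less_irrefl less_trans)
  show "convex M"
  proof (rule convex_on_lineI[OF subL[unfolded L_def] \<open>d \<noteq> 0\<close>])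
    fix r t r' :: real
    assume t: "r < t" "t < r'" and r: "x + r *\<^sub>R d \<in> M" "x + r' *\<^sub>R d \<in> M"
    obtain m where m: "m \<in> M" "m \<noteq> x + r *\<^sub>R d" "m \<noteq> x + r' *\<^sub>R d"
      using third by blast
    obtain s where s: "m = x + s *\<^sub>R d" using m subL by (auto simp: L_def)
    have "x + t *\<^sub>R d \<in> frontier K"
      using frontier_line_between[OF K(1,2) \<open>d \<noteq> 0\<close> t, of s x] r m s M by auto
    \<comment> \<open>The same argument on the parallel line shifted by \<open>- v\<close>, which
      carries the second condition in the definition of \<open>M\<close>.\<close>
    moreover have "(x - v) + t *\<^sub>R d \<in> frontier K"
      using frontier_line_between[OF K(1,2) \<open>d \<noteq> 0\<close> t, of s "x - v"] r m s M
      by (auto simp: algebra_simps)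
    ultimately show "x + t *\<^sub>R d \<in> M"
      unfolding M by (simp add: algebra_simps)
  qed
qed

lemma mem_translate: "x \<in> (+) v ` C \<longleftrightarrow> x - v \<in> (C :: 'a::ab_group_add set)"
  by (metis add_diff_cancel_left' diff_add_cancel add.commute imageE imageI)

text \<open>If \<open>m'\<close> lies ahead of \<open>m\<close> along \<open>v\<close>, then
  \<open>m\<close> is a frontier point between \<open>m - v\<close> and \<open>m'\<close>; otherwise
  exchange the two.\<close>

lemma no_interior_at_shared_height:
  fixes K :: "(real^2) set"
  assumes K: "convex K" "closed K" and "v \<noteq> 0"
    and m: "m \<in> frontier K" "m - v \<in> frontier K" "m' \<in> frontier K" "m' - v \<in> frontier K" "m \<noteq> m'"
    and h: "rot v \<bullet> m = y" "rot v \<bullet> m' = y" and c: "c \<in> interior K"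
  shows "rot v \<bullet> c \<noteq> y"
proof
  assume cy: "rot v \<bullet> c = y"
  have sub: "frontier K \<subseteq> K"
    using K by (simp add: frontier_subset_closed)
  have *: False if ab: "a \<in> frontier K" "a - v \<in> frontier K" "a + r *\<^sub>R v \<in> frontier K" "r > 0" "rot v \<bullet> a = y" for a r
  proof -
    obtain s where s: "c = a + s *\<^sub>R v"
      using rot_eq_on_line[OF \<open>v \<noteq> 0\<close>, of a c] cy ab by auto
    show False
      using frontier_line_no_interior[OF K \<open>v \<noteq> 0\<close>, of "-1" 0 r a s] ab sub s c by auto
  qed
  obtain r where r: "m' = m + r *\<^sub>R v"
    using rot_eq_on_line[OF \<open>v \<noteq> 0\<close>, of m m'] h by auto
  consider "r > 0" | "r < 0"
    using r m by fastforce
  then show False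
    using *[of m r] *[of m' "- r"] m h r by cases auto
qed

text \<open>\<open>K\<close> fills the strip between the heights \<open>y\<close> and
  \<open>y'\<close>. A translate reaching both of these heights has no shift across the strip, so at
  height \<open>y\<close> it again shows a flat side and its trace on \<open>S\<close> is convex.
  Hence a translate with a nonconvex trace on \<open>S\<close> stays away from the opposite
  side.\<close>

lemma opposite_flat_side_disjoint:
  fixes K S :: "'a::euclidean_space set"
  assumes K: "convex K" "closed K" "interior K \<noteq> {}"
    and y: "p \<in> K" "n \<bullet> p = y" "p' \<in> K" "n \<bullet> p' = y'" "y \<noteq> y'"
    and flat: "\<And>c. c \<in> interior K \<Longrightarrow> n \<bullet> c \<noteq> y \<and> n \<bullet> c \<noteq> y'"
    and S: "convex S" "\<And>x. x \<in> S \<Longrightarrow> n \<bullet> x = y"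
    and nc: "\<not> convex (S \<inter> (+) c ` frontier K)"
    and x: "x \<in> (+) c ` frontier K"
  shows "n \<bullet> x \<noteq> y'"
proof
  assume xy: "n \<bullet> x = y'"
  have sub: "frontier K \<subseteq> K"
    using K by (simp add: frontier_subset_closed)
  have strip: "min y y' \<le> n \<bullet> z \<and> n \<bullet> z \<le> max y y'" if z: "z \<in> K" for z
  proof (rule ccontr)
    assume "\<not> ?thesis"
    then consider "n \<bullet> z < y" "y < y'" | "n \<bullet> z < y'" "y' < y" | "y < y'" "y' < n \<bullet> z" | "y' < y" "y < n \<bullet> z"
      using \<open>y \<noteq> y'\<close> by linarith
    then show False
    proof cases
      case 1 then show ?thesis
        using interior_at_height[OF K(1,3) z y(3), of n y] y flat by auto
    next
      case 2 then show ?thesis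
        using interior_at_height[OF K(1,3) z y(1), of n y'] y flat by auto
    next
      case 3 then show ?thesis
        using interior_at_height[OF K(1,3) y(1) z, of n y'] y flat by auto
    next
      case 4 then show ?thesis
        using interior_at_height[OF K(1,3) y(3) z, of n y] y flat by auto
    qed
  qed
  have "S \<inter> (+) c ` frontier K \<noteq> {}"
    using nc by (metis convex_empty)
  then obtain q where q: "q \<in> S" "q - c \<in> K"
    using sub mem_translate[of _ c "frontier K"] by blast
  have "n \<bullet> (q - c) = y - n \<bullet> c" "n \<bullet> (x - c) = y' - n \<bullet> c"
    using S(2) q xy by (auto simp: inner_diff_right)
  moreover have "x - c \<in> K"
    using x sub by (auto simp: mem_translate)
  \<comment> \<open>Two points of \<open>K\<close> differ in height by the full width of the strip,
    so they lie on its two boundary lines in the same order.\<close>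
  ultimately have nc0: "n \<bullet> c = 0"
    using strip[of "q - c"] strip[of "x - c"] q \<open>y \<noteq> y'\<close> by linarith
  have "S \<inter> (+) c ` frontier K = S \<inter> (+) c ` K"
  proof -
    have "z - c \<in> frontier K" if "z \<in> S" "z - c \<in> K" for z
    proof -
      have "n \<bullet> (z - c) = y"
        using S(2)[OF that(1)] nc0 by (simp add: inner_diff_right)
      then have "z - c \<notin> interior K" using flat by blast
      then show ?thesis using that K(2) by (simp add: frontier_def)
    qed
    then show ?thesis
      using sub mem_translate[of _ c "frontier K"] mem_translate[of _ c K] by blast
  qed
  then show False
    using nc S(1) K(1) by (simp add: convex_Int convex_translation)
qed

lemma frontier_inter_translate_level_convex:
  fixes K :: "(real^2) set"
  assumes K: "convex K" "closed K" and "v \<noteq> 0"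
  shows "convex {x \<in> frontier K. x - v \<in> frontier K \<and> rot v \<bullet> x = y}" (is "convex ?S")
proof (cases "?S = {}")
  case False
  then obtain a where a: "rot v \<bullet> a = y" by blast
  have "rot v \<bullet> x = y \<longleftrightarrow> x \<in> {a + t *\<^sub>R v | t. True}" for x
  proof
    assume "rot v \<bullet> x = y"
    then show "x \<in> {a + t *\<^sub>R v | t. True}"
      using rot_eq_on_line[OF \<open>v \<noteq> 0\<close>, of a x] a by simp
  next
    assume "x \<in> {a + t *\<^sub>R v | t. True}"
    then show "rot v \<bullet> x = y"
      using a by (auto simp: inner_add_right rot_inner_self)
  qed
  then show ?thesis
    using frontier_inter_translate_line_convex[OF K \<open>v \<noteq> 0\<close>, of a] by simp
qed (simp only: convex_empty)

lemma at_most_two_values: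
  fixes f :: "'a \<Rightarrow> real"
  assumes "\<not> (\<exists>x\<in>M. \<exists>y\<in>M. \<exists>z\<in>M. f x < f y \<and> f y < f z)"
  shows "\<exists>a b. \<forall>x\<in>M. f x = a \<or> f x = b"
proof (rule ccontr)
  assume neg: "\<not> ?thesis"
  then have ex: "\<exists>x\<in>M. f x \<noteq> a \<and> f x \<noteq> b" for a b
    by blast
  obtain x where x: "x \<in> M" using ex by blast
  obtain y where y: "y \<in> M" "f y \<noteq> f x" using ex by blast
  obtain z where z: "z \<in> M" "f z \<noteq> f x" "f z \<noteq> f y" using ex by blast
  have no: "\<not> (f p < f q \<and> f q < f r)" if "p \<in> M" "q \<in> M" "r \<in> M" for p q r
    using assms that by blast
  show False
    using no[OF x y(1) z(1)] no[OF x z(1) y(1)] no[OF y(1) x z(1)] no[OF y(1) z(1) x]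
      no[OF z(1) x y(1)] no[OF z(1) y(1) x] y z by linarith
qed

section \<open>Counting the members that miss the intersection of two translates\<close>

definition frontier_translates :: "'a::euclidean_space set \<Rightarrow> 'a set set \<Rightarrow> bool" where
  "frontier_translates K F \<longleftrightarrow> (\<forall>Z\<in>F. \<exists>c. Z = (+) c ` frontier K)"

lemma frontier_translates_closed: "frontier_translates K F \<Longrightarrow> Z \<in> F \<Longrightarrow> closed Z"
  unfolding frontier_translates_def by (metis closed_translation frontier_closed)

lemma frontier_translates_trace:
  assumes "frontier_translates K F" "Z \<in> F" "convex K" "closed K"
    and "convex S" "S \<subseteq> {a + t *\<^sub>R d | t. True}" "d \<noteq> 0"
  obtains "convex (S \<inter> Z)" | p q where "S \<inter> Z \<subseteq> {p, q}"
proof -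
  obtain c where "Z = frontier ((+) c ` K)"
    using assms(1,2) unfolding frontier_translates_def by (metis frontier_translation)
  moreover have "convex ((+) c ` K)" "closed ((+) c ` K)"
    using assms by (simp_all add: convex_translation closed_translation)
  ultimately show ?thesis
    using frontier_inter_line[of "(+) c ` K", OF _ _ assms(5-7)] that by blast
qed

text \<open>An unbounded closed convex set has a recession direction and thus contains a ray. In
  this way the absence of rays substitutes for finiteness of the family.\<close>

lemma compact_if_no_ray:
  fixes S :: "(real^2) set"
  assumes "convex S" "closed S" "S \<subseteq> C" "\<not> contains_ray C"
  shows "compact S"
proof -
  have "bounded S"
  proof (rule ccontr)
    assume nb: "\<not> bounded S"
    obtain d where d: "d \<noteq> 0" "\<And>x t. x \<in> S \<Longrightarrow> t \<ge> 0 \<Longrightarrow> x + t *\<^sub>R d \<in> S"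
      using unbounded_convex_recession[OF assms(1,2) nb] by blast
    obtain a where "a \<in> S" using nb by fastforce
    then have "\<forall>t\<ge>0. a + t *\<^sub>R d \<in> C"
      using assms(3) d(2) by blast
    then show False
      using assms(4) d(1) unfolding contains_ray_def by blast
  qed
  then show ?thesis
    using assms by (simp add: compact_eq_bounded_closed)
qed

text \<open>If all traces on \<open>S\<close> are convex, one-dimensional Helly gives 2. Otherwise
  one member has a trace of at most two points, each removed by one more member, which gives 1 + 2.
  The second alternative records the nonconvex trace because it makes the opposite level
  cheap.\<close>

lemma misses_line:
  fixes K :: "'a::euclidean_space set"
  assumes F: "frontier_translates K F" "\<Inter>F = {}" and K: "convex K" "closed K"
    and S: "convex S" "closed S" "S \<subseteq> {a + t *\<^sub>R d | t. True}" "d \<noteq> 0" and fin: "finite F \<or> compact S"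
  shows "misses F S 2 \<or> (\<exists>Z\<in>F. \<not> convex (S \<inter> Z)) \<and> misses F S 3"
proof (cases "\<forall>Z\<in>F. convex (S \<inter> Z)")
  case True
  then show ?thesis
    using misses_segment[OF S(3) _ _ fin] frontier_translates_closed[OF F(1)] F(2) by simp
next
  case False
  then obtain Z where Z: "Z \<in> F" "\<not> convex (S \<inter> Z)" by blast
  obtain p q where "S \<inter> Z \<subseteq> {p, q}"
    using frontier_translates_trace[OF F(1) Z(1) K S(1,3,4)] Z(2) by blast
  then have "misses F (S \<inter> Z) 2"
    using F(2) by (intro misses_doubleton[of _ _ p q]) auto
  then have "misses F S 3"
    using misses_Int[OF Z(1)] by (simp add: numeral_3_eq_3 numeral_2_eq_2)
  then show ?thesis using Z by blast
qed

text \<open>Two members cut the plane down to \<open>M\<close>, so \<open>M\<close> may cost 4. If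
  \<open>M\<close> has three heights it is a convex piece of one line and costs at most 3. If it has
  at most two, each level costs 2, or one costs 3 and then the other costs only 1.\<close>

lemma misses_frontier_translates:
  fixes K :: "(real^2) set"
  assumes F: "frontier_translates K F" "\<Inter>F = {}" and K: "convex K" "closed K" "interior K \<noteq> {}"
    and XY: "frontier K \<in> F" "(+) v ` frontier K \<in> F" "v \<noteq> 0"
    and fin: "finite F \<or> \<not> contains_ray (frontier K)"
  shows "misses F UNIV 6"
proof -
  define M where "M = {x \<in> frontier K. x - v \<in> frontier K}"
  have sub: "frontier K \<subseteq> K"
    using K by (simp add: frontier_subset_closed)
  have Meq: "M = frontier K \<inter> (+) v ` frontier K"
    by (auto simp: M_def mem_translate)
  have closedM: "closed M"
    unfolding Meq by (simp add: closed_Int closed_translation)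
  have final: "misses F UNIV 6" if "misses F M 4"
    using misses_Int[OF XY(1), of UNIV 5] misses_Int[OF XY(2), of "frontier K" 4] that
    by (simp add: Meq)
  have fin': "finite F \<or> compact S" if "convex S" "closed S" "S \<subseteq> M" for S
    using fin compact_if_no_ray[OF that(1,2), of "frontier K"] that(3) by (auto simp: M_def)
  show ?thesis
  proof (cases "\<exists>x\<in>M. \<exists>y\<in>M. \<exists>w\<in>M. rot v \<bullet> x < rot v \<bullet> y \<and> rot v \<bullet> y < rot v \<bullet> w")
    case True
    then obtain x y w where xyw: "x \<in> M" "y \<in> M" "w \<in> M" "rot v \<bullet> x < rot v \<bullet> y" "rot v \<bullet> y < rot v \<bullet> w"
      by blast
    have cvM: "convex M"
      using three_heights_collinear(2)[OF K XY(3) M_def xyw] .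
    obtain a d where lM: "d \<noteq> 0" "M \<subseteq> {a + t *\<^sub>R d | t. True}"
      using three_heights_collinear(1)[OF K XY(3) M_def xyw] by blast
    have "misses F M 2 \<or> misses F M 3"
      using misses_line[OF F K(1,2) cvM closedM lM(2,1) fin'[OF cvM closedM order_refl]] by blast
    then have "misses F M 3"
      using misses_mono[of F M 2 F M 3] by auto
    then show ?thesis using final misses_mono[of F M 3 F M 4] by simp
  next
    case False
    then obtain y1 y2 where y: "\<forall>x\<in>M. rot v \<bullet> x = y1 \<or> rot v \<bullet> x = y2"
      using at_most_two_values[of M "\<lambda>x. rot v \<bullet> x"] by blast
    define S where "S y = {x \<in> M. rot v \<bullet> x = y}" for y
    have Sline: "S y \<subseteq> {a + t *\<^sub>R v | t. True}" if "a \<in> S y" for a y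
      using rot_eq_on_line[OF XY(3)] that by (force simp: S_def)
    have Sconv: "convex (S y)" for y
      using frontier_inter_translate_level_convex[OF K(1,2) XY(3)] by (simp add: S_def M_def)
    have Sclosed: "closed (S y)" for y
    proof -
      have "S y = M \<inter> {x. rot v \<bullet> x = y}" by (auto simp: S_def)
      then show ?thesis using closedM closed_hyperplane by (metis closed_Int)
    qed
    have alt: "misses F (S y) 2 \<or> (\<exists>Z\<in>F. \<not> convex (S y \<inter> Z)) \<and> misses F (S y) 3" for y
    proof (cases "S y = {}")
      case False
      then obtain a where a: "a \<in> S y" by blast
      have "S y \<subseteq> M" by (auto simp: S_def)
      then show ?thesis
        using misses_line[OF F K(1,2) Sconv Sclosed Sline[OF a] XY(3) fin'[OF Sconv Sclosed]]
        by blast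
    qed (simp add: misses_empty)
    have SD: "x \<in> frontier K \<and> x - v \<in> frontier K \<and> rot v \<bullet> x = y" if "x \<in> S y" for x y
      using that by (simp add: S_def M_def)
    have flat: "rot v \<bullet> u \<noteq> y" if p: "p \<in> S y" "p' \<in> S y" "p \<noteq> p'" and u: "u \<in> interior K" for p p' y u
      by (rule no_interior_at_shared_height[OF K(1,2) XY(3), of p p'])
         (use SD[OF p(1)] SD[OF p(2)] p(3) u in simp_all)
    \<comment> \<open>A nonconvex trace forces \<open>S y\<close> to have two points. If
      \<open>S y'\<close> has two points as well, neither height contains interior points of
      \<open>K\<close>, both levels are on opposite flat sides, and \<open>Z\<close> itself misses
      \<open>S y'\<close>.\<close>
    have bad: "misses F (S y') 1" if y': "y \<noteq> y'" and Z: "Z \<in> F" "\<not> convex (S y \<inter> Z)" for y y' Z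
    proof (cases "\<exists>p. S y' \<subseteq> {p}")
      case True
      then obtain p where "S y' \<subseteq> {p}" by blast
      then show ?thesis using F(2) misses_subsingleton[of "S y'" F p] by simp
    next
      case False
      then obtain p p' where p: "p \<in> S y'" "p' \<in> S y'" "p \<noteq> p'" by blast
      have "\<not> S y \<subseteq> {q}" for q
      proof
        assume "S y \<subseteq> {q}"
        then have "S y \<inter> Z = {} \<or> S y \<inter> Z = {q}" by blast
        then show False using Z(2) by auto
      qed
      then obtain q q' where q: "q \<in> S y" "q' \<in> S y" "q \<noteq> q'" by blast
      obtain c where c: "Z = (+) c ` frontier K"
        using F(1) Z(1) unfolding frontier_translates_def by blast
      have "rot v \<bullet> x \<noteq> y'" if "x \<in> Z" for x
      proof (rule opposite_flat_side_disjoint[OF K, of q "rot v" y p y' "S y" c x])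
        show "\<not> convex (S y \<inter> (+) c ` frontier K)" "x \<in> (+) c ` frontier K"
          using Z(2) that c by simp_all
        show "rot v \<bullet> u \<noteq> y \<and> rot v \<bullet> u \<noteq> y'" if "u \<in> interior K" for u
          using flat[OF p that] flat[OF q that] by simp
      qed (use SD p q sub y' Sconv in blast)+
      then have "S y' \<inter> Z = {}"
        using SD by blast
      then show ?thesis
        using misses_Int[OF Z(1), of "S y'" 0] misses_empty[of F 0] by simp
    qed
    have "misses F (S y1 \<union> S y2) 4"
    proof (cases "y1 = y2")
      case True
      then show ?thesis
        using alt[of y2] misses_mono[of F "S y2" _ F "S y2" 4] by auto
    next
      case False
      consider "misses F (S y1) 2" "misses F (S y2) 2"
        | "misses F (S y1) 3" "misses F (S y2) 1" | "misses F (S y1) 1" "misses F (S y2) 3"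
        using alt[of y1] alt[of y2] bad[OF False] bad[OF False[symmetric]] by fastforce
      then show ?thesis
        using misses_Un[of F "S y1" 2 "S y2" 2] misses_Un[of F "S y1" 3 "S y2" 1]
          misses_Un[of F "S y1" 1 "S y2" 3] by cases simp_all
    qed
    moreover have "S y1 \<union> S y2 = M" using y by (auto simp: S_def)
    ultimately show ?thesis using final by simp
  qed
qed

section \<open>Degenerate curves and curves containing a line\<close>

text \<open>Passing to the closure of a convex set does not change its interior, hence neither its
  frontier.\<close>

lemma convex_curve_frontier:
  assumes "convex_curve C"
  obtains K where "convex K" "closed K" "K \<noteq> UNIV" "C = frontier K"
proof -
  obtain B where B: "convex B" "B \<noteq> UNIV" "C = frontier B"
    using assms unfolding convex_curve_def by blast
  have "interior (closure B) = interior B"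
    using B(1) by (rule convex_interior_closure)
  then have "frontier (closure B) = C" "closure B \<noteq> UNIV"
    using B(2,3) interior_subset[of B] by (auto simp: frontier_def)
  then show ?thesis
    using that[of "closure B"] B(1) by (auto simp: convex_closure)
qed

lemma translates_frontier_translates:
  "F \<subseteq> translates (frontier K) \<longleftrightarrow> frontier_translates K F"
  unfolding translates_def frontier_translates_def by blast

lemma contains_ray_translate:
  assumes "contains_ray ((+) v ` C)" shows "contains_ray C"
proof -
  obtain a d where "d \<noteq> 0" "\<forall>t\<ge>0. a + t *\<^sub>R d \<in> (+) v ` C"
    using assms unfolding contains_ray_def by blast
  then show ?thesis
    unfolding contains_ray_def mem_translate
    by (intro exI[of _ "a - v"] exI[of _ d]) (simp add: algebra_simps)
qed

lemma empty_interior_on_line: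
  fixes K :: "(real^2) set"
  assumes "convex K" "interior K = {}"
  obtains n where "n \<noteq> 0" "\<And>x y. x \<in> K \<Longrightarrow> y \<in> K \<Longrightarrow> \<exists>t. y = x + t *\<^sub>R n"
proof -
  obtain a b where ab: "a \<noteq> 0" "K \<subseteq> {x. a \<bullet> x = b}"
    using empty_interior_subset_hyperplane[OF assms] by blast
  have r: "rot (rot a) = - a"
    by (simp add: rot_def vec_eq_iff forall_2)
  have "\<exists>t. y = x + t *\<^sub>R rot a" if "x \<in> K" "y \<in> K" for x y
  proof (rule rot_eq_on_line)
    show "rot a \<noteq> 0" using ab by (simp add: rot_nonzero)
    have "a \<bullet> x = a \<bullet> y" using ab(2) that by auto
    then show "rot (rot a) \<bullet> x = rot (rot a) \<bullet> y"
      by (simp add: r)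
  qed
  then show ?thesis
    using that[of "rot a"] ab(1) rot_nonzero by blast
qed

text \<open>Without interior points the curve is \<open>K\<close> itself, a convex subset of a line.
  One member supplies the line, and one-dimensional Helly on it costs 2 more.\<close>

lemma misses_degenerate:
  fixes K :: "(real^2) set"
  assumes F: "frontier_translates K F" "\<Inter>F = {}" and K: "convex K" "closed K" "interior K = {}"
    and fin: "finite F \<or> \<not> contains_ray (frontier K)"
  shows "misses F UNIV 3"
proof -
  have fK: "frontier K = K"
    using K by (simp add: frontier_def)
  have cv: "convex Z" "closed Z" if "Z \<in> F" for Z
    using F(1) that K fK unfolding frontier_translates_def
    by (metis convex_translation, metis closed_translation)
  obtain X where X: "X \<in> F" using F(2) by fastforce
  obtain c where c: "X = (+) c ` K"
    using F(1) X fK unfolding frontier_translates_def by metis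
  obtain n where n: "\<And>x y. x \<in> K \<Longrightarrow> y \<in> K \<Longrightarrow> \<exists>t. y = x + t *\<^sub>R n"
    using empty_interior_on_line[OF K(1,3)] by metis
  have fin': "finite F \<or> compact X"
    using fin compact_if_no_ray[OF cv[OF X] order_refl] contains_ray_translate[of c K] fK c by metis
  have "misses F X 2"
  proof (cases "X = {}")
    case True then show ?thesis by (simp add: misses_empty)
  next
    case False
    then obtain a where a: "a \<in> K" using c by blast
    have "X \<subseteq> {(a + c) + t *\<^sub>R n | t. True}"
    proof
      fix x assume "x \<in> X"
      then obtain t where "x - c = a + t *\<^sub>R n"
        using n[OF a] c mem_translate by blast
      then show "x \<in> {(a + c) + t *\<^sub>R n | t. True}"
        by (auto simp: algebra_simps intro!: exI[of _ t])
    qed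
    then show ?thesis
      using misses_segment[of X "a + c" n F] cv X fin' F(2) by (simp add: convex_Int)
  qed
  then show ?thesis
    using misses_Int[OF X, of UNIV 2] by simp
qed

text \<open>Points of the ray at parameter \<open>t / e n\<close>, taken with weight
  \<open>e n\<close>, contribute the displacement \<open>t *\<^sub>R d\<close> however small the
  weight; let \<open>e n\<close> tend to 0.\<close>

lemma closed_convex_ray_recession:
  fixes K :: "'a::euclidean_space set"
  assumes "convex K" "closed K" and ray: "\<And>t. t \<ge> 0 \<Longrightarrow> a + t *\<^sub>R d \<in> K" and "x \<in> K" "t \<ge> 0"
  shows "x + t *\<^sub>R d \<in> K"
proof -
  define e where "e n = inverse (real (Suc n))" for n
  have e0: "e \<longlonglongrightarrow> 0"
    unfolding e_def by (rule LIMSEQ_inverse_real_of_nat)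
  have "x + t *\<^sub>R d + e n *\<^sub>R (a - x) \<in> K" for n
  proof -
    have e: "0 < e n" "e n \<le> 1"
      by (auto simp: e_def field_simps)
    have "(1 - e n) *\<^sub>R x + e n *\<^sub>R (a + (t / e n) *\<^sub>R d) \<in> K"
      using e assms(4,5) by (intro convexD[OF assms(1)] ray) auto
    moreover have "(1 - e n) *\<^sub>R x + e n *\<^sub>R (a + (t / e n) *\<^sub>R d) = x + t *\<^sub>R d + e n *\<^sub>R (a - x)"
      using e by (simp add: algebra_simps)
    ultimately show ?thesis by simp
  qed
  moreover have "(\<lambda>n. x + t *\<^sub>R d + e n *\<^sub>R (a - x)) \<longlonglongrightarrow> x + t *\<^sub>R d + 0 *\<^sub>R (a - x)"
    by (intro tendsto_intros e0)
  ultimately show ?thesis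
    using closed_sequentially[OF assms(2)] by fastforce
qed

text \<open>A line in \<open>K\<close> makes \<open>K\<close>, and every member of \<open>F\<close>,
  invariant under translation along it. The curve therefore has at most two heights, since a middle
  one would consist of interior points, so it is made of at most two parallel lines. A member that
  misses one point of such a line misses all of it: the cost is 1 + 1 + 1, and \<open>F\<close> may
  be infinite.\<close>

lemma misses_line_curve:
  fixes K :: "(real^2) set"
  assumes F: "frontier_translates K F" "\<Inter>F = {}" and K: "convex K" "closed K"
    and line: "contains_line (frontier K)"
  shows "misses F UNIV 3"
proof -
  have sub: "frontier K \<subseteq> K"
    using K by (simp add: frontier_subset_closed)
  obtain a d where d: "d \<noteq> 0" "\<And>t. a + t *\<^sub>R d \<in> frontier K"
    using line unfolding contains_line_def by blast
  have inv: "x + t *\<^sub>R d \<in> K" if x: "x \<in> K" for x t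
  proof (cases "t \<ge> 0")
    case True
    then show ?thesis
      using closed_convex_ray_recession[OF K _ x, of a d t] d sub by blast
  next
    case False
    have "a + s *\<^sub>R (- d) \<in> K" for s
      using d(2)[of "- s"] sub by auto
    then show ?thesis
      using closed_convex_ray_recession[OF K _ x, of a "- d" "- t"] False by auto
  qed
  have "(+) (t *\<^sub>R d) ` K = K" for t
  proof -
    have "x \<in> (+) (t *\<^sub>R d) ` K \<longleftrightarrow> x \<in> K" for x
      using inv[of x "- t"] inv[of "x - t *\<^sub>R d" t] by (auto simp: mem_translate)
    then show ?thesis by blast
  qed
  then have invi: "(+) (t *\<^sub>R d) ` interior K = interior K" "(+) (t *\<^sub>R d) ` frontier K = frontier K" for t
    by (metis interior_translation, metis frontier_translation)
  have invf: "x + t *\<^sub>R d \<in> Z" if "x \<in> Z" "Z \<in> F" for x t Z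
  proof -
    obtain c where c: "Z = (+) c ` frontier K"
      using F(1) \<open>Z \<in> F\<close> unfolding frontier_translates_def by blast
    then have "x - c \<in> frontier K" using that mem_translate by blast
    then have "t *\<^sub>R d + (x - c) \<in> frontier K" using invi(2)[of t] by blast
    then show ?thesis
      using c mem_translate[of "x + t *\<^sub>R d" c "frontier K"] by (simp add: algebra_simps)
  qed
  have "\<exists>y1 y2. \<forall>x\<in>frontier K. rot d \<bullet> x = y1 \<or> rot d \<bullet> x = y2"
  proof (cases "interior K = {}")
    case True
    then obtain n where n: "n \<noteq> 0" "\<And>x y. x \<in> K \<Longrightarrow> y \<in> K \<Longrightarrow> \<exists>t. y = x + t *\<^sub>R n"
      using empty_interior_on_line[OF K(1)] by metis
    obtain s where "a + 1 *\<^sub>R d = (a + 0 *\<^sub>R d) + s *\<^sub>R n"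
      using n(2)[of "a + 0 *\<^sub>R d" "a + 1 *\<^sub>R d"] d(2) sub by blast
    then have s: "d = s *\<^sub>R n" "s \<noteq> 0" using d(1) by auto
    have "rot d \<bullet> x = rot d \<bullet> a" if x: "x \<in> frontier K" for x
    proof -
      obtain t where "x = a + t *\<^sub>R n"
        using n(2)[of a x] d(2)[of 0] x sub by auto
      then have "x = a + (t / s) *\<^sub>R d" using s by simp
      then show ?thesis by (simp add: inner_add_right rot_inner_self)
    qed
    then show ?thesis by blast
  next
    case False
    show ?thesis
    proof (rule at_most_two_values, safe)
      fix x y z assume *: "x \<in> frontier K" "y \<in> frontier K" "z \<in> frontier K"
        "rot d \<bullet> x < rot d \<bullet> y" "rot d \<bullet> y < rot d \<bullet> z"
      obtain c where c: "c \<in> interior K" "rot d \<bullet> c = rot d \<bullet> y"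
        using interior_at_height[OF K(1) False _ _ *(4,5)] * sub by blast
      then obtain t where "y = c + t *\<^sub>R d"
        using rot_eq_on_line[OF d(1), of c y] by auto
      then have "y \<in> interior K"
        using invi(1)[of t] c(1) by (metis add.commute imageI)
      then show False using *(2) by (simp add: frontier_def)
    qed
  qed
  then obtain y1 y2 where y: "\<And>x. x \<in> frontier K \<Longrightarrow> rot d \<bullet> x = y1 \<or> rot d \<bullet> x = y2" by blast
  obtain X where X: "X \<in> F" using F(2) by fastforce
  obtain c where c: "X = (+) c ` frontier K"
    using F(1) X unfolding frontier_translates_def by blast
  have one: "misses F {x \<in> X. rot d \<bullet> x = h} 1" for h
  proof (cases "{x \<in> X. rot d \<bullet> x = h} = {}")
    case True
    then show ?thesis by (simp only: misses_empty)
  next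
    case False
    then obtain x where x: "x \<in> X" "rot d \<bullet> x = h" by blast
    then obtain Z where Z: "Z \<in> F" "x \<notin> Z" using F(2) by blast
    have "z \<notin> Z" if zh: "rot d \<bullet> z = h" for z
    proof
      assume "z \<in> Z"
      moreover obtain t where "x = z + t *\<^sub>R d"
        using rot_eq_on_line[OF d(1), of z x] zh x(2) by auto
      ultimately show False using invf Z by blast
    qed
    then have "{x \<in> X. rot d \<bullet> x = h} \<inter> Z = {}" by blast
    then show ?thesis
      using misses_Int[OF Z(1), of _ 0] misses_empty[of F 0] by (metis One_nat_def)
  qed
  have "X \<subseteq> {x \<in> X. rot d \<bullet> x = y1 + rot d \<bullet> c} \<union> {x \<in> X. rot d \<bullet> x = y2 + rot d \<bullet> c}"
  proof
    fix x assume "x \<in> X"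
    then have "x - c \<in> frontier K" using c mem_translate by blast
    then show "x \<in> {x \<in> X. rot d \<bullet> x = y1 + rot d \<bullet> c} \<union> {x \<in> X. rot d \<bullet> x = y2 + rot d \<bullet> c}"
      using y[of "x - c"] \<open>x \<in> X\<close> by (auto simp: inner_diff_right)
  qed
  then have "misses F X 2"
    using misses_mono[OF misses_Un[OF one one] order_refl] by simp
  then show ?thesis
    using misses_Int[OF X, of UNIV 2] by simp
qed

lemma misses_translates:
  fixes K :: "(real^2) set"
  assumes F: "frontier_translates K F" "\<Inter>F = {}" and K: "convex K" "closed K"
    and fin: "finite F \<or> (contains_ray (frontier K) \<longrightarrow> contains_line (frontier K))"
  shows "misses F UNIV 6"
proof -
  have m: "misses F UNIV 6" if "misses F UNIV 3"
    by (rule misses_mono[OF that]) auto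
  consider "contains_line (frontier K)" | "interior K = {}" "\<not> contains_line (frontier K)"
    | "interior K \<noteq> {}" "\<not> contains_line (frontier K)" by blast
  then show ?thesis
  proof cases
    case 1
    then show ?thesis using misses_line_curve[OF F K] m by blast
  next
    case 2
    then show ?thesis using misses_degenerate[OF F K] m fin by blast
  next
    case 3
    then have fin': "finite F \<or> \<not> contains_ray (frontier K)" using fin by blast
    obtain X where X: "X \<in> F" using F(2) by fastforce
    show ?thesis
    proof (cases "F = {X}")
      case True
      then have "misses F UNIV 1"
        unfolding misses_def using F(2) by (intro exI[of _ F]) auto
      then show ?thesis by (rule misses_mono) auto
    next
      case False
      then obtain Y where Y: "Y \<in> F" "X \<noteq> Y" using X by blast
      obtain a where a: "X = (+) a ` frontier K"
        using F(1) X unfolding frontier_translates_def by blast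
      obtain b where b: "Y = (+) b ` frontier K"
        using F(1) Y(1) unfolding frontier_translates_def by blast
      note ab = a b
      \<comment> \<open>Normalisation: the shift by \<open>a\<close> makes \<open>X\<close> the
        frontier of the reference body, and \<open>Y\<close> its translate by
        \<open>b - a\<close>.\<close>
      define K' where "K' = (+) a ` K"
      have fK': "frontier K' = X"
        unfolding K'_def ab(1) by (rule frontier_translation)
      have Z: "(+) c ` frontier K = (+) (c - a) ` frontier K'" for c
        unfolding fK' ab(1) by (simp add: image_image algebra_simps)
      show ?thesis
      proof (rule misses_frontier_translates)
        show "frontier_translates K' F"
          using F(1) unfolding frontier_translates_def Z by blast
        show "convex K'" "closed K'" "interior K' \<noteq> {}"
          unfolding K'_def using K 3(1) by (simp_all add: convex_translation closed_translation interior_translation)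
        show "frontier K' \<in> F" "(+) (b - a) ` frontier K' \<in> F"
          using X Y Z[of b] fK' ab(2) by simp_all
        show "b - a \<noteq> 0" using Y ab by auto
        show "finite F \<or> \<not> contains_ray (frontier K')"
          using fin' contains_ray_translate[of a "frontier K"] unfolding fK' ab(1) by blast
      qed (rule F(2))
    qed
  qed
qed

section \<open>Strictly convex curves\<close>

lemma strictly_convex_subset:
  assumes "strictly_convex_curve C" "convex S" "S \<subseteq> C" "x \<in> S" "y \<in> S"
  shows "x = y"
  using assms closed_segment_subset unfolding strictly_convex_curve_def by (metis order_trans)

text \<open>Each level of \<open>M\<close> is a convex subset of the curve, hence at most a point,
  and three levels would make \<open>M\<close> itself a nontrivial convex subset of the
  curve.\<close>

lemma strictly_convex_two_points:
  assumes C: "strictly_convex_curve C" and "v \<noteq> 0"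
  shows "\<exists>p q. {x \<in> C. x - v \<in> C} \<subseteq> {p, q}"
proof -
  obtain K where K: "convex K" "closed K" "C = frontier K"
    using C convex_curve_frontier unfolding strictly_convex_curve_def by metis
  define M where "M = {x \<in> frontier K. x - v \<in> frontier K}"
  have MC: "M \<subseteq> C" by (auto simp: M_def K)
  have level: "x = y" if "x \<in> M" "y \<in> M" "rot v \<bullet> x = rot v \<bullet> y" for x y
  proof (rule strictly_convex_subset[OF C])
    show "convex {z \<in> frontier K. z - v \<in> frontier K \<and> rot v \<bullet> z = rot v \<bullet> y}"
      by (rule frontier_inter_translate_level_convex[OF K(1,2) \<open>v \<noteq> 0\<close>])
  qed (use that in \<open>auto simp: K M_def\<close>)
  have "\<exists>y1 y2. \<forall>x\<in>M. rot v \<bullet> x = y1 \<or> rot v \<bullet> x = y2"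
  proof (cases "interior K = {}")
    case True
    then have "frontier K = K" using K(2) by (simp add: frontier_def)
    then have "x = y" if "x \<in> M" "y \<in> M" for x y
      using strictly_convex_subset[OF C, of K x y] K(1,3) that MC by auto
    then have "\<forall>x\<in>M. rot v \<bullet> x = rot v \<bullet> (SOME y. y \<in> M)"
      by (metis someI)
    then show ?thesis by blast
  next
    case False
    show ?thesis
    proof (rule at_most_two_values, rule notI, elim bexE conjE)
      fix x y w assume *: "x \<in> M" "y \<in> M" "w \<in> M" "rot v \<bullet> x < rot v \<bullet> y" "rot v \<bullet> y < rot v \<bullet> w"
      have "convex M"
        by (rule three_heights_collinear(2)[OF K(1,2) False \<open>v \<noteq> 0\<close> M_def *])
      then show False
        using strictly_convex_subset[OF C _ MC *(1,2)] *(4) by simp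
    qed
  qed
  then obtain y1 y2 where y: "\<forall>x\<in>M. rot v \<bullet> x = y1 \<or> rot v \<bullet> x = y2" by blast
  have "M \<subseteq> {SOME x. x \<in> M \<and> rot v \<bullet> x = y1, SOME x. x \<in> M \<and> rot v \<bullet> x = y2}"
  proof
    fix x assume x: "x \<in> M"
    have "(SOME z. z \<in> M \<and> rot v \<bullet> z = rot v \<bullet> x) = x"
      by (rule some_equality) (use x level in auto)
    then show "x \<in> {SOME x. x \<in> M \<and> rot v \<bullet> x = y1, SOME x. x \<in> M \<and> rot v \<bullet> x = y2}"
      using bspec[OF y x] by auto
  qed
  then show ?thesis
    unfolding M_def K(3) by blast
qed

lemma translates_two_points:
  assumes C: "strictly_convex_curve C" and "X \<in> translates C" "Y \<in> translates C" "X \<noteq> Y"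
  shows "\<exists>p q. X \<inter> Y \<subseteq> {p, q}"
proof -
  obtain a b where ab: "X = (+) a ` C" "Y = (+) b ` C"
    using assms unfolding translates_def by blast
  then have "b - a \<noteq> 0" using assms by auto
  then obtain p q where pq: "{x \<in> C. x - (b - a) \<in> C} \<subseteq> {p, q}"
    using strictly_convex_two_points[OF C] by blast
  have "x = p + a \<or> x = q + a" if "x \<in> X \<inter> Y" for x
  proof -
    have "x - a \<in> {x \<in> C. x - (b - a) \<in> C}"
      using that ab mem_translate[of x a C] mem_translate[of x b C] by simp
    then show ?thesis using pq by (auto simp: algebra_simps)
  qed
  then show ?thesis by blast
qed

text \<open>Dual of the two-point bound: if \<open>x \<noteq> y\<close>, then \<open>x - a\<close>,
  \<open>x - b\<close> and \<open>x - c\<close> are all ends of chords that are translates of one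
  vector, and there are at most two such ends.\<close>

lemma three_translates_one_point:
  assumes C: "strictly_convex_curve C"
    and XYZ: "X \<in> translates C" "Y \<in> translates C" "Z \<in> translates C" "X \<noteq> Y" "X \<noteq> Z" "Y \<noteq> Z"
    and xy: "x \<in> X" "x \<in> Y" "x \<in> Z" "y \<in> X" "y \<in> Y" "y \<in> Z"
  shows "x = y"
proof (rule ccontr)
  assume "x \<noteq> y"
  obtain a b c where abc: "X = (+) a ` C" "Y = (+) b ` C" "Z = (+) c ` C"
    using XYZ unfolding translates_def by blast
  obtain p q where pq: "{z \<in> C. z - (x - y) \<in> C} \<subseteq> {p, q}"
    using strictly_convex_two_points[OF C, of "x - y"] \<open>x \<noteq> y\<close> by auto
  have "x - a \<in> {p, q}" "x - b \<in> {p, q}" "x - c \<in> {p, q}"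
    using pq xy abc by (auto simp: mem_translate)
  then have "a = b \<or> a = c \<or> b = c" by auto
  then show False using XYZ abc by blast
qed

text \<open>Pure incidence combinatorics: pairs share at most two points, triples exactly one. With
  five members the pigeonhole principle makes triple points coincide.\<close>

lemma common_point_of_triples:
  assumes two: "\<And>X Y. X \<in> F \<Longrightarrow> Y \<in> F \<Longrightarrow> X \<noteq> Y \<Longrightarrow> \<exists>p q. X \<inter> Y \<subseteq> {p, q}"
    and dual: "\<And>X Y Z x y. X \<in> F \<Longrightarrow> Y \<in> F \<Longrightarrow> Z \<in> F \<Longrightarrow> X \<noteq> Y \<Longrightarrow> X \<noteq> Z \<Longrightarrow> Y \<noteq> Z \<Longrightarrow>
      x \<in> X \<inter> Y \<inter> Z \<Longrightarrow> y \<in> X \<inter> Y \<inter> Z \<Longrightarrow> x = y"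
    and triple: "\<And>X Y Z. X \<in> F \<Longrightarrow> Y \<in> F \<Longrightarrow> Z \<in> F \<Longrightarrow> X \<noteq> Y \<Longrightarrow> X \<noteq> Z \<Longrightarrow> Y \<noteq> Z \<Longrightarrow> \<exists>x. x \<in> X \<inter> Y \<inter> Z"
    and five: "infinite F \<or> 5 \<le> card F"
  shows "\<Inter>F \<noteq> {}"
proof -
  \<comment> \<open>The triple points of \<open>A\<close>, \<open>H\<close> with each of
    \<open>B\<close>, \<open>D\<close>, \<open>E\<close> are three points of
    \<open>A \<inter> H\<close>, so two coincide. The coincidence lies in three of the four members
    through \<open>p\<close>, so it is \<open>p\<close>, and it lies in \<open>H\<close>.\<close>
  have spread: "p \<in> H"
    if D: "A \<in> F" "B \<in> F" "D \<in> F" "E \<in> F" "H \<in> F" "distinct [A, B, D, E, H]"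
      and p: "p \<in> A" "p \<in> B" "p \<in> D" "p \<in> E" for A B D E H p
  proof (rule ccontr)
    assume pH: "p \<notin> H"
    have ne: "A \<noteq> B" "A \<noteq> D" "A \<noteq> E" "A \<noteq> H" "B \<noteq> D" "B \<noteq> E" "B \<noteq> H" "D \<noteq> E" "D \<noteq> H" "E \<noteq> H"
      using D(6) by auto
    obtain x1 where x1: "x1 \<in> A" "x1 \<in> B" "x1 \<in> H" using triple[OF D(1,2,5) ne(1,4,7)] by blast
    obtain x2 where x2: "x2 \<in> A" "x2 \<in> D" "x2 \<in> H" using triple[OF D(1,3,5) ne(2,4,9)] by blast
    obtain x3 where x3: "x3 \<in> A" "x3 \<in> E" "x3 \<in> H" using triple[OF D(1,4,5) ne(3,4,10)] by blast
    obtain u w where uw: "A \<inter> H \<subseteq> {u, w}" using two[OF D(1,5) ne(4)] by blast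
    have "x1 = x2 \<or> x1 = x3 \<or> x2 = x3"
    proof -
      have "x1 \<in> {u, w}" "x2 \<in> {u, w}" "x3 \<in> {u, w}"
        using subsetD[OF uw] x1 x2 x3 by simp_all
      then show ?thesis by auto
    qed
    then consider "x1 = x2" | "x1 = x3" | "x2 = x3" by blast
    then show False
    proof cases
      case 1 then show ?thesis using dual[OF D(1,2,3) ne(1,2,5), of x1 p] x1 x2 p pH by simp
    next
      case 2 then show ?thesis using dual[OF D(1,2,4) ne(1,3,6), of x1 p] x1 x3 p pH by simp
    next
      case 3 then show ?thesis using dual[OF D(1,3,4) ne(2,3,8), of x2 p] x2 x3 p pH by simp
    qed
  qed
  \<comment> \<open>The triple points of \<open>A\<close>, \<open>B\<close> with each of
    \<open>D\<close>, \<open>E\<close>, \<open>H\<close> lie in \<open>A \<inter> B\<close>, so two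
    coincide and four members share a point. If \<open>H\<close> is among them,
    \<open>spread\<close> exchanges it for the missing one.\<close>
  have five_common: "\<exists>p. p \<in> A \<and> p \<in> B \<and> p \<in> D \<and> p \<in> E"
    if D: "A \<in> F" "B \<in> F" "D \<in> F" "E \<in> F" "H \<in> F" "distinct [A, B, D, E, H]" for A B D E H
  proof -
    have ne: "A \<noteq> B" "A \<noteq> D" "A \<noteq> E" "A \<noteq> H" "B \<noteq> D" "B \<noteq> E" "B \<noteq> H" "D \<noteq> E" "D \<noteq> H" "E \<noteq> H"
      using D(6) by auto
    obtain x1 where x1: "x1 \<in> A" "x1 \<in> B" "x1 \<in> D" using triple[OF D(1,2,3) ne(1,2,5)] by blast
    obtain x2 where x2: "x2 \<in> A" "x2 \<in> B" "x2 \<in> E" using triple[OF D(1,2,4) ne(1,3,6)] by blast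
    obtain x3 where x3: "x3 \<in> A" "x3 \<in> B" "x3 \<in> H" using triple[OF D(1,2,5) ne(1,4,7)] by blast
    obtain u w where uw: "A \<inter> B \<subseteq> {u, w}" using two[OF D(1,2) ne(1)] by blast
    have "x1 = x2 \<or> x1 = x3 \<or> x2 = x3"
    proof -
      have "x1 \<in> {u, w}" "x2 \<in> {u, w}" "x3 \<in> {u, w}"
        using subsetD[OF uw] x1 x2 x3 by simp_all
      then show ?thesis by auto
    qed
    then consider "x1 = x2" | "x1 = x3" | "x2 = x3" by blast
    moreover have dd: "distinct [A, B, D, H, E]" "distinct [A, B, E, H, D]"
      using D(6) by auto
    ultimately show ?thesis
    proof cases
      case 1
      then show ?thesis using x1 x2 by blast
    next
      case 2
      then show ?thesis using spread[OF D(1,2,3,5,4) dd(1), of x1] x1 x3 by blast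
    next
      case 3
      then show ?thesis using spread[OF D(1,2,4,5,3) dd(2), of x2] x2 x3 by blast
    qed
  qed
  obtain G where G: "G \<subseteq> F" "finite G" "card G = 5"
    using five by (meson infinite_arbitrarily_large obtain_subset_with_card_n)
  have another: "\<exists>Y\<in>F. Y \<notin> set L" if "length L \<le> 4" for L
  proof (rule ccontr)
    assume "\<not> ?thesis"
    then have "G \<subseteq> set L" using G by blast
    then have "card G \<le> card (set L)" by (simp add: card_mono)
    then show False using G(3) card_length[of L] that by linarith
  qed
  obtain A where A: "A \<in> F" using another[of "[]"] by auto
  obtain B where B: "B \<in> F" "B \<noteq> A" using another[of "[A]"] by auto
  obtain D where D: "D \<in> F" "D \<noteq> A" "D \<noteq> B" using another[of "[A, B]"] by auto
  obtain p where p: "p \<in> A \<inter> B \<inter> D" using triple[OF A B(1) D(1) B(2)[symmetric] D(2)[symmetric] D(3)[symmetric]] by blast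
  \<comment> \<open>The point \<open>p\<close> is the only common point of \<open>A\<close>,
    \<open>B\<close>, \<open>D\<close>; an auxiliary fifth member \<open>Y\<close> shows that it
    lies in \<open>X\<close>.\<close>
  have "p \<in> X" if X: "X \<in> F" for X
  proof (cases "X \<in> {A, B, D}")
    case True then show ?thesis using p by auto
  next
    case False
    obtain Y where Y: "Y \<in> F" "Y \<noteq> A" "Y \<noteq> B" "Y \<noteq> D" "Y \<noteq> X"
      using another[of "[A, B, D, X]"] by auto
    have "distinct [A, B, D, X, Y]"
      using B(2) D(2,3) Y False by auto
    then obtain q where q: "q \<in> A" "q \<in> B" "q \<in> D" "q \<in> X"
      using five_common[OF A B(1) D(1) X Y(1)] by blast
    then have "q = p"
      using dual[OF A B(1) D(1) B(2)[symmetric] D(2)[symmetric] D(3)[symmetric], of q p] p by simp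
    then show ?thesis using q by simp
  qed
  then show ?thesis by blast
qed

lemma strictly_convex_triples_suffice:
  assumes C: "strictly_convex_curve C"
  shows "triples_suffice C 5"
  unfolding triples_suffice_def
proof (intro allI impI, elim conjE)
  fix F assume F: "F \<subseteq> translates C" and tr: "\<forall>G\<subseteq>F. card G = 3 \<longrightarrow> \<Inter>G \<noteq> {}" and five: "infinite F \<or> 5 \<le> card F"
  show "\<Inter>F \<noteq> {}"
  proof (rule common_point_of_triples[OF _ _ _ five])
    show "\<exists>p q. X \<inter> Y \<subseteq> {p, q}" if "X \<in> F" "Y \<in> F" "X \<noteq> Y" for X Y
      using translates_two_points[OF C] that F by blast
    show "x = y" if "X \<in> F" "Y \<in> F" "Z \<in> F" "X \<noteq> Y" "X \<noteq> Z" "Y \<noteq> Z" "x \<in> X \<inter> Y \<inter> Z" "y \<in> X \<inter> Y \<inter> Z" for X Y Z x y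
      using three_translates_one_point[OF C, of X Y Z x y] that F by blast
    show "\<exists>x. x \<in> X \<inter> Y \<inter> Z" if "X \<in> F" "Y \<in> F" "Z \<in> F" "X \<noteq> Y" "X \<noteq> Z" "Y \<noteq> Z" for X Y Z
    proof -
      have "card {X, Y, Z} = 3" using that by simp
      then have "\<Inter>{X, Y, Z} \<noteq> {}" using tr that by (metis empty_subsetI insert_subset)
      then show ?thesis by auto
    qed
  qed
qed

text \<open>A family of five or more members is settled by its triples; a smaller one is itself
  among the tested subfamilies.\<close>

lemma strictly_convex_helly_four:
  assumes C: "strictly_convex_curve C"
  shows "helly_property (translates C) 4"
  unfolding helly_property_def
proof (intro allI impI)
  fix F assume F: "F \<subseteq> translates C" and G: "\<forall>G\<subseteq>F. finite G \<and> card G \<le> 4 \<longrightarrow> \<Inter>G \<noteq> {}"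
  show "\<Inter>F \<noteq> {}"
  proof (cases "infinite F \<or> 5 \<le> card F")
    case True
    have "\<forall>G\<subseteq>F. card G = 3 \<longrightarrow> \<Inter>G \<noteq> {}"
    proof (intro allI impI)
      fix H assume H: "H \<subseteq> F" "card H = 3"
      have "finite H" by (rule card_ge_0_finite) (simp add: H)
      then show "\<Inter>H \<noteq> {}" using G H by simp
    qed
    then show ?thesis
      using strictly_convex_triples_suffice[OF C] F True unfolding triples_suffice_def by blast
  next
    case False
    then show ?thesis using G by simp
  qed
qed

section \<open>The Minkowski gauge\<close>

text \<open>The Minkowski functional about the origin, used for radial projection to the frontier.
  For unbounded \<open>K\<close> it may vanish at nonzero points.\<close>

definition mgauge :: "'a::real_normed_vector set \<Rightarrow> 'a \<Rightarrow> real" where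
  "mgauge K x = Inf {t. 0 < t \<and> (1 / t) *\<^sub>R x \<in> K}"

context
  fixes K :: "'a::euclidean_space set"
  assumes K: "convex K" "closed K" "0 \<in> interior K"
begin

lemma mgauge_set_nonempty: "\<exists>t>0. (1 / t) *\<^sub>R x \<in> K"
proof -
  obtain e where e: "e > 0" "cball 0 e \<subseteq> K"
    using K(3) by (auto simp: mem_interior_cball)
  define t where "t = (norm x + 1) / e"
  have "t > 0"
    unfolding t_def by (rule divide_pos_pos) (use e norm_ge_zero[of x] in linarith)+
  moreover have "norm ((1 / t) *\<^sub>R x) \<le> e"
  proof -
    have "e * t = norm x + 1" using e by (simp add: t_def)
    then show ?thesis using \<open>t > 0\<close> by (simp add: pos_divide_le_eq)
  qed
  ultimately show ?thesis using e by (intro exI[of _ t]) (auto simp: dist_norm)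
qed

lemma mgauge_bdd_below: "bdd_below {t. 0 < t \<and> (1 / t) *\<^sub>R x \<in> K}"
  by (rule bdd_belowI[of _ 0]) auto

lemma mgauge_nonneg: "0 \<le> mgauge K x"
  unfolding mgauge_def using mgauge_set_nonempty[of x] by (intro cInf_greatest) auto

lemma mgauge_mono_scale:
  assumes "0 < s" "s \<le> t" "(1 / s) *\<^sub>R x \<in> K"
  shows "(1 / t) *\<^sub>R x \<in> K"
proof -
  have "(1 - s / t) *\<^sub>R 0 + (s / t) *\<^sub>R ((1 / s) *\<^sub>R x) \<in> K"
    using assms K(3) interior_subset[of K] by (intro convexD[OF K(1)]) auto
  then show ?thesis using assms by simp
qed

text \<open>Every value slightly above \<open>t\<close> is admissible because \<open>K\<close> is
  star-shaped about 0; closedness of \<open>K\<close> allows the passage to the limit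
  \<open>t\<close>.\<close>

lemma mgauge_le_iff:
  assumes "0 < t"
  shows "mgauge K x \<le> t \<longleftrightarrow> (1 / t) *\<^sub>R x \<in> K"
proof
  assume "(1 / t) *\<^sub>R x \<in> K"
  then show "mgauge K x \<le> t"
    unfolding mgauge_def using assms by (intro cInf_lower mgauge_bdd_below) auto
next
  assume le: "mgauge K x \<le> t"
  have "(1 / (t + inverse (real (Suc n)))) *\<^sub>R x \<in> K" for n
  proof -
    have "mgauge K x < t + inverse (real (Suc n))"
      using le by (smt (verit) inverse_positive_iff_positive of_nat_0_less_iff zero_less_Suc)
    then obtain s where "0 < s" "(1 / s) *\<^sub>R x \<in> K" "s < t + inverse (real (Suc n))"
      unfolding mgauge_def using cInf_lessD[of "{t. 0 < t \<and> (1 / t) *\<^sub>R x \<in> K}"] mgauge_set_nonempty[of x]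
      by auto
    then show ?thesis
      using mgauge_mono_scale[of s] by simp
  qed
  moreover have "(\<lambda>n. (1 / (t + inverse (real (Suc n)))) *\<^sub>R x) \<longlonglongrightarrow> (1 / (t + 0)) *\<^sub>R x"
    by (intro tendsto_intros LIMSEQ_inverse_real_of_nat) (use assms in auto)
  ultimately show "(1 / t) *\<^sub>R x \<in> K"
    using closed_sequentially[OF K(2)] by fastforce
qed

lemma mgauge_scale:
  assumes "0 \<le> c"
  shows "mgauge K (c *\<^sub>R x) = c * mgauge K x"
proof (cases "c = 0")
  case True
  have "mgauge K 0 \<le> 0"
  proof (rule field_le_epsilon)
    fix e :: real assume "e > 0"
    then show "mgauge K 0 \<le> 0 + e"
      using mgauge_le_iff[of e 0] K(3) interior_subset[of K] by auto
  qed
  then show ?thesis using True mgauge_nonneg[of 0] by simp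
next
  case False
  then have c: "c > 0" using assms by simp
  have "mgauge K (c *\<^sub>R x) \<le> t \<longleftrightarrow> c * mgauge K x \<le> t" if "t > 0" for t
  proof -
    have "c * mgauge K x \<le> t \<longleftrightarrow> mgauge K x \<le> t / c"
      using c by (simp add: field_simps)
    also have "\<dots> \<longleftrightarrow> (1 / (t / c)) *\<^sub>R x \<in> K"
      using mgauge_le_iff[of "t / c" x] c that by simp
    also have "\<dots> \<longleftrightarrow> mgauge K (c *\<^sub>R x) \<le> t"
      using mgauge_le_iff[of t "c *\<^sub>R x"] c that by simp
    finally show ?thesis by simp
  qed
  note le = this
  show ?thesis
  proof (rule antisym)
    show "mgauge K (c *\<^sub>R x) \<le> c * mgauge K x"
    proof (rule field_le_epsilon)
      fix e :: real assume "e > 0"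
      then show "mgauge K (c *\<^sub>R x) \<le> c * mgauge K x + e"
        using le[of "c * mgauge K x + e"] c mgauge_nonneg[of x] by (simp add: add_nonneg_pos)
    qed
    show "c * mgauge K x \<le> mgauge K (c *\<^sub>R x)"
    proof (rule field_le_epsilon)
      fix e :: real assume "e > 0"
      then show "c * mgauge K x \<le> mgauge K (c *\<^sub>R x) + e"
        using le[of "mgauge K (c *\<^sub>R x) + e"] mgauge_nonneg[of "c *\<^sub>R x"] by (simp add: add_nonneg_pos)
    qed
  qed
qed

lemma mgauge_triangle: "mgauge K (x + y) \<le> mgauge K x + mgauge K y"
proof (rule field_le_epsilon)
  fix e :: real assume e: "e > 0"
  define s t where "s = mgauge K x + e / 2" and "t = mgauge K y + e / 2"
  have st: "s > 0" "t > 0"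
    using e mgauge_nonneg[of x] mgauge_nonneg[of y] by (auto simp: s_def t_def)
  have "(1 / s) *\<^sub>R x \<in> K" "(1 / t) *\<^sub>R y \<in> K"
    using mgauge_le_iff[OF st(1), of x] mgauge_le_iff[OF st(2), of y] e by (auto simp: s_def t_def)
  then have "(s / (s + t)) *\<^sub>R ((1 / s) *\<^sub>R x) + (t / (s + t)) *\<^sub>R ((1 / t) *\<^sub>R y) \<in> K"
    using st by (intro convexD[OF K(1)]) (auto simp: add_divide_distrib[symmetric])
  then have "(1 / (s + t)) *\<^sub>R (x + y) \<in> K"
    using st by (simp add: scaleR_right_distrib)
  then have "mgauge K (x + y) \<le> s + t"
    using mgauge_le_iff[of "s + t"] st by simp
  then show "mgauge K (x + y) \<le> mgauge K x + mgauge K y + e"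
    by (simp add: s_def t_def)
qed

text \<open>The gauge is sublinear, hence a finite convex function on the whole space.\<close>

lemma continuous_on_mgauge: "continuous_on S (mgauge K)"
proof -
  have "convex_on UNIV (mgauge K)"
  proof (rule convex_onI)
    fix t :: real and x y :: 'a assume "0 < t" "t < 1"
    then show "mgauge K ((1 - t) *\<^sub>R x + t *\<^sub>R y) \<le> (1 - t) * mgauge K x + t * mgauge K y"
      using mgauge_triangle[of "(1 - t) *\<^sub>R x" "t *\<^sub>R y"] by (simp add: mgauge_scale)
  qed simp
  then show ?thesis
    using convex_on_continuous[OF open_UNIV] continuous_on_subset by blast
qed

text \<open>The interior is the set of gauge less than 1: this set is open by continuity, and an
  interior point remains in \<open>K\<close> when stretched by some factor
  \<open>c > 1\<close>.\<close>

lemma mgauge_frontier: "x \<in> frontier K \<longleftrightarrow> mgauge K x = 1"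
proof -
  have mem: "x \<in> K \<longleftrightarrow> mgauge K x \<le> 1" for x
    using mgauge_le_iff[of 1 x] by simp
  have "open {x. mgauge K x < 1}"
    by (rule open_Collect_less) (auto intro: continuous_on_mgauge)
  then have "{x. mgauge K x < 1} \<subseteq> interior K"
    by (rule interior_maximal[rotated]) (auto simp: mem)
  moreover have "mgauge K x < 1" if xi: "x \<in> interior K" for x
  proof (cases "x = 0")
    case True
    then show ?thesis using mgauge_scale[of 0 0] by simp
  next
    case False
    obtain e where e: "e > 0" "cball x e \<subseteq> K"
      using xi by (auto simp: mem_interior_cball)
    define c where "c = 1 + e / norm x"
    have "c > 1" using e False by (simp add: c_def)
    have "norm (x - c *\<^sub>R x) = e"
    proof -
      have "x - c *\<^sub>R x = - ((e / norm x) *\<^sub>R x)" by (simp add: c_def algebra_simps)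
      then show ?thesis using e False by simp
    qed
    then have "c *\<^sub>R x \<in> K" using e by (auto simp: dist_norm)
    then have "c * mgauge K x \<le> 1"
      using mem mgauge_scale[of c x] \<open>c > 1\<close> by simp
    moreover have "c * 1 \<le> c * mgauge K x" if "1 \<le> mgauge K x"
      using that \<open>c > 1\<close> by (intro mult_left_mono) auto
    ultimately show ?thesis
      using \<open>c > 1\<close> by linarith
  qed
  ultimately have "x \<in> interior K \<longleftrightarrow> mgauge K x < 1" by blast
  moreover have "x \<in> frontier K \<longleftrightarrow> x \<in> K \<and> x \<notin> interior K"
    using K(2) by (simp add: frontier_def)
  ultimately show ?thesis
    using mem[of x] by linarith
qed

lemma mgauge_pos:
  assumes "\<exists>t\<ge>0. t *\<^sub>R x \<notin> K"
  shows "mgauge K x > 0"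
proof (rule ccontr)
  assume "\<not> ?thesis"
  then have z: "mgauge K x = 0" using mgauge_nonneg[of x] by simp
  obtain t where t: "t \<ge> 0" "t *\<^sub>R x \<notin> K" using assms by blast
  then have "mgauge K (t *\<^sub>R x) \<le> 1" using z mgauge_scale[of t x] by simp
  then show False using t mgauge_le_iff[of 1 "t *\<^sub>R x"] by simp
qed

lemma mgauge_normalize:
  assumes "mgauge K x > 0"
  shows "(1 / mgauge K x) *\<^sub>R x \<in> frontier K"
  using assms by (simp add: mgauge_frontier mgauge_scale)

end

section \<open>Unbounded strictly convex curves\<close>

lemma strictly_convex_not_between:
  assumes C: "strictly_convex_curve C" "C = frontier K" "convex K" "closed K"
    and "x \<in> C" "u \<in> K" "w \<in> K" "x \<in> open_segment u w"
  shows False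
proof -
  have "u \<noteq> w" using assms(8) by auto
  then show False
    using frontier_segment_subset[of K x u w] assms unfolding strictly_convex_curve_def by blast
qed

lemma strictly_convex_no_three_collinear:
  assumes C: "strictly_convex_curve C" "C = frontier K" "convex K" "closed K"
    and "d \<noteq> 0" "r \<noteq> s" "s \<noteq> t" "r \<noteq> t" "a + r *\<^sub>R d \<in> C" "a + s *\<^sub>R d \<in> C" "a + t *\<^sub>R d \<in> C"
  shows False
proof -
  have sub: "C \<subseteq> K" using C by (simp add: frontier_subset_closed)
  have *: False if "p < q" "q < w" "a + p *\<^sub>R d \<in> C" "a + q *\<^sub>R d \<in> C" "a + w *\<^sub>R d \<in> C" for p q w
    using strictly_convex_not_between[OF C that(4)] open_segment_on_line[OF that(1,2) \<open>d \<noteq> 0\<close>] that(3,5) sub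
    by blast
  show False
    using *[of r s t] *[of r t s] *[of s r t] *[of s t r] *[of t r s] *[of t s r] assms by linarith
qed

lemma vec2_span:
  fixes u v d :: "real^2"
  assumes "rot u \<bullet> v \<noteq> 0"
  obtains \<alpha> \<beta> where "d = \<alpha> *\<^sub>R u + \<beta> *\<^sub>R v"
proof
  define D where "D = u $ 1 * v $ 2 - u $ 2 * v $ 1"
  have "D \<noteq> 0" using assms by (simp add: D_def rot_inner)
  then have "d $ 1 * D = (d $ 1 * v $ 2 - d $ 2 * v $ 1) * u $ 1 + (u $ 1 * d $ 2 - u $ 2 * d $ 1) * v $ 1"
    "d $ 2 * D = (d $ 1 * v $ 2 - d $ 2 * v $ 1) * u $ 2 + (u $ 1 * d $ 2 - u $ 2 * d $ 1) * v $ 2"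
    by (simp_all add: D_def algebra_simps)
  with \<open>D \<noteq> 0\<close> show "d = ((d $ 1 * v $ 2 - d $ 2 * v $ 1) / D) *\<^sub>R u + ((u $ 1 * d $ 2 - u $ 2 * d $ 1) / D) *\<^sub>R v"
    by (simp add: vec_eq_iff forall_2 nonzero_eq_divide_eq flip: add_divide_distrib)
qed

text \<open>Two common points span with \<open>v\<close> a parallelogram inscribed in the curve; the vertex lying
  farthest in the recession direction \<open>d\<close> is then not extreme.\<close>

lemma unbounded_strictly_convex_one_point:
  assumes C: "strictly_convex_curve C" "C = frontier K" "convex K" "closed K" and "v \<noteq> 0"
    and d: "d \<noteq> 0" "\<And>x t. x \<in> K \<Longrightarrow> t \<ge> 0 \<Longrightarrow> x + t *\<^sub>R d \<in> K"
    and xy: "x \<in> C" "x - v \<in> C" "y \<in> C" "y - v \<in> C"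
  shows "x = y"
proof (rule ccontr)
  assume ne: "x \<noteq> y"
  have sub: "C \<subseteq> K" using C by (simp add: frontier_subset_closed)
  define u where "u = x - y"
  have "u \<noteq> 0" using ne by (simp add: u_def)
  \<comment> \<open>Otherwise \<open>x\<close>, \<open>x - v\<close>, \<open>y\<close>,
    \<open>y - v\<close> are collinear, and at least three of them are distinct.\<close>
  have ind: "rot u \<bullet> v \<noteq> 0"
  proof
    assume "rot u \<bullet> v = 0"
    then obtain r where r: "x = y + r *\<^sub>R v"
      using rot_eq_on_line[OF \<open>v \<noteq> 0\<close>, of y x]
      by (auto simp: u_def rot_inner algebra_simps)
    have "r \<noteq> 0" using r ne by auto
    show False
    \<comment> \<open>For \<open>r = -1\<close> the points \<open>x\<close> and \<open>y - v\<close>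
      coincide, and \<open>x - v\<close> has to serve as the third one.\<close>
    proof (cases "r = -1")
      case True
      then have "x - v = y + (- 2) *\<^sub>R v" using r by (simp add: vec_eq_iff)
      then show False
        using strictly_convex_no_three_collinear[OF C \<open>v \<noteq> 0\<close>, of 0 r "-2" y] xy r True by simp
    next
      case False
      then show False
        using strictly_convex_no_three_collinear[OF C \<open>v \<noteq> 0\<close>, of 0 r "-1" y] xy r \<open>r \<noteq> 0\<close> by auto
    qed
  qed
  obtain \<alpha> \<beta> where ab: "d = \<alpha> *\<^sub>R u + \<beta> *\<^sub>R v" using vec2_span[OF ind] .
  define c where "c = y - v"
  have vert: "c + i *\<^sub>R u + j *\<^sub>R v \<in> C" if "i \<in> {0, 1}" "j \<in> {0, 1}" for i j :: real
    using that xy by (auto simp: c_def u_def)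
  have inside: "c + i *\<^sub>R u + j *\<^sub>R v \<in> K" if "0 \<le> i" "i \<le> 1" "0 \<le> j" "j \<le> 1" for i j
  proof -
    have *: "c + i *\<^sub>R u + k *\<^sub>R v \<in> K" if "k \<in> {0, 1}" for k
    proof -
      have "(1 - i) *\<^sub>R (c + 0 *\<^sub>R u + k *\<^sub>R v) + i *\<^sub>R (c + 1 *\<^sub>R u + k *\<^sub>R v) \<in> K"
        by (intro convexD[OF C(3)] subsetD[OF sub vert]) (use that \<open>0 \<le> i\<close> \<open>i \<le> 1\<close> in auto)
      then show ?thesis by (simp add: algebra_simps)
    qed
    have "(1 - j) *\<^sub>R (c + i *\<^sub>R u + 0 *\<^sub>R v) + j *\<^sub>R (c + i *\<^sub>R u + 1 *\<^sub>R v) \<in> K"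
      by (intro convexD[OF C(3)] *) (use that in auto)
    then show ?thesis by (simp add: algebra_simps)
  qed
  \<comment> \<open>The vertex is chosen by the signs of the coordinates of \<open>d\<close>, so
    that a step along \<open>- d\<close> enters the parallelogram; \<open>e\<close> is small enough
    for the step to remain inside.\<close>
  define i j e where "i = (if \<alpha> \<ge> 0 then 1 else 0::real)" and "j = (if \<beta> \<ge> 0 then 1 else 0::real)"
    and "e = 1 / (1 + \<bar>\<alpha>\<bar> + \<bar>\<beta>\<bar>)"
  have e: "e > 0" "e * \<bar>\<alpha>\<bar> \<le> 1" "e * \<bar>\<beta>\<bar> \<le> 1"
    by (auto simp: e_def field_simps add_pos_nonneg)
  define p where "p = c + i *\<^sub>R u + j *\<^sub>R v"
  have p: "p \<in> C" unfolding p_def by (rule vert) (auto simp: i_def j_def)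
  have "p + (- e) *\<^sub>R d = c + (i - e * \<alpha>) *\<^sub>R u + (j - e * \<beta>) *\<^sub>R v"
    unfolding p_def ab by (simp add: algebra_simps)
  also have "\<dots> \<in> K"
    using e by (intro inside) (auto simp: i_def j_def abs_if mult_nonneg_nonneg mult_nonneg_nonpos split: if_splits)
  finally have "p + (- e) *\<^sub>R d \<in> K" .
  moreover have "p + 1 *\<^sub>R d \<in> K" using d(2)[of p 1] p sub by auto
  moreover have "p \<in> open_segment (p + (- e) *\<^sub>R d) (p + 1 *\<^sub>R d)"
    using open_segment_on_line[of "- e" 0 1 d p] e d by simp
  ultimately show False
    using strictly_convex_not_between[OF C p] by blast
qed

lemma unbounded_recession:
  fixes K :: "'a::euclidean_space set"
  assumes "C = frontier K" "convex K" "closed K" "\<not> bounded C"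
  obtains d where "d \<noteq> 0" "\<And>x t. x \<in> K \<Longrightarrow> t \<ge> 0 \<Longrightarrow> x + t *\<^sub>R d \<in> K"
proof -
  have "\<not> bounded K"
    using assms by (meson bounded_subset frontier_subset_closed)
  then show ?thesis
    using unbounded_convex_recession[OF assms(2,3)] that by blast
qed

text \<open>Two distinct members have a single common point, and every third member must pass
  through it.\<close>

lemma unbounded_strictly_convex_helly_three:
  assumes C: "strictly_convex_curve C" and "\<not> bounded C"
  shows "helly_property (translates C) 3"
  unfolding helly_property_def
proof (intro allI impI)
  fix F assume F: "F \<subseteq> translates C" and G: "\<forall>G\<subseteq>F. finite G \<and> card G \<le> 3 \<longrightarrow> \<Inter>G \<noteq> {}"
  obtain K where K: "C = frontier K" "convex K" "closed K"
    using C convex_curve_frontier unfolding strictly_convex_curve_def by metis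
  obtain d where d: "d \<noteq> 0" "\<And>x t. x \<in> K \<Longrightarrow> t \<ge> 0 \<Longrightarrow> x + t *\<^sub>R d \<in> K"
    using unbounded_recession[OF K \<open>\<not> bounded C\<close>] by blast
  show "\<Inter>F \<noteq> {}"
  proof (cases "\<exists>X Y. X \<in> F \<and> Y \<in> F \<and> X \<noteq> Y")
    case False
    then have "F = {} \<or> (\<exists>X. F = {X})" by blast
    then have "finite F" "card F \<le> 3" by auto
    then show ?thesis using G by blast
  next
    case True
    then obtain X Y where XY: "X \<in> F" "Y \<in> F" "X \<noteq> Y" by blast
    have meet: "X \<inter> Y \<inter> Z \<noteq> {}" if "Z \<in> F" for Z
    proof -
      have "{X, Y, Z} \<subseteq> F" "finite {X, Y, Z}" "card {X, Y, Z} \<le> 3"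
        using XY that by (auto simp: card_insert_if)
      then have "\<Inter>{X, Y, Z} \<noteq> {}" using G by blast
      then show ?thesis by (simp add: Int_assoc)
    qed
    obtain p where p: "p \<in> X" "p \<in> Y" using meet[OF XY(1)] by blast
    have one: "q = p" if q: "q \<in> X" "q \<in> Y" for q
    proof -
      obtain a where a: "X = (+) a ` C" using XY F unfolding translates_def by blast
      obtain b where b: "Y = (+) b ` C" using XY F unfolding translates_def by blast
      have "b - a \<noteq> 0" using a b XY by auto
      then have "q - a = p - a"
        by (rule unbounded_strictly_convex_one_point[OF C K _ d, of "b - a"])
           (use p q mem_translate[of _ a C] mem_translate[of _ b C] a b in simp_all)
      then show ?thesis by simp
    qed
    have "p \<in> Z" if "Z \<in> F" for Z
      using meet[OF that] one by blast
    then show ?thesis by blast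
  qed
qed

text \<open>Starting from any chord \<open>p q\<close>, half of its vector is again realised by a
  chord: along an arc of the curve from \<open>p\<close> to \<open>q\<close>, the point shifted by
  \<open>v\<close> begins in \<open>K\<close> and ends outside it.\<close>

lemma unbounded_strictly_convex_half_chord:
  assumes C: "strictly_convex_curve C" and nb: "\<not> bounded C"
  obtains v p s where "v \<noteq> 0" "p \<in> C" "p + 2 *\<^sub>R v \<in> C" "s \<in> C" "s + v \<in> C"
proof -
  obtain K where K: "C = frontier K" "convex K" "closed K"
    using C convex_curve_frontier unfolding strictly_convex_curve_def by metis
  have sub: "C \<subseteq> K" using K by (simp add: frontier_subset_closed)
  obtain d where d: "d \<noteq> 0" "\<And>x t. x \<in> K \<Longrightarrow> t \<ge> 0 \<Longrightarrow> x + t *\<^sub>R d \<in> K"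
    using unbounded_recession[OF K \<open>\<not> bounded C\<close>] by blast
  have "\<not> C \<subseteq> {p}" for p
    using nb bounded_subset[of "{p}" C] by auto
  then obtain p q where pq: "p \<in> C" "q \<in> C" "p \<noteq> q" by blast
  define v where "v = (1/2) *\<^sub>R (q - p)"
  have v: "v \<noteq> 0" "q = p + 2 *\<^sub>R v" using pq by (auto simp: v_def)
  have nb': False if "r < s" "s < t" "p + r *\<^sub>R v \<in> K" "p + s *\<^sub>R v \<in> C" "p + t *\<^sub>R v \<in> K" for r s t
    using strictly_convex_not_between[OF C K that(4,3,5)] open_segment_on_line[OF that(1,2) v(1)] by blast
  have mid: "p + v \<in> interior K"
  proof -
    have "(1/2) *\<^sub>R p + (1/2) *\<^sub>R q \<in> K"
      by (rule convexD[OF K(2)]) (use pq sub in auto)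
    moreover have "(1/2) *\<^sub>R p + (1/2) *\<^sub>R q = p + v"
      by (simp add: v_def vec_eq_iff field_simps)
    ultimately have "p + v \<in> K" by simp
    moreover have "p + v \<notin> C"
      using nb'[of 0 1 2] pq sub v by auto
    ultimately show ?thesis
      using K by (simp add: frontier_def)
  qed
  \<comment> \<open>The centre of projection is the midpoint of the chord pushed along the recession
    direction; seen from there, the chord projects to an arc of the curve.\<close>
  define z where "z = p + v + d"
  have zi: "z \<in> interior K"
  proof -
    have "(+) d ` interior K \<subseteq> K"
      using d(2)[of _ 1] interior_subset[of K] by (auto simp: add.commute)
    then have "(+) d ` interior K \<subseteq> interior K"
      by (simp add: interior_maximal open_translation)
    then show ?thesis using mid unfolding z_def by (metis add.commute imageI subsetD)
  qed
  define K0 where "K0 = (+) (- z) ` K"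
  have K0: "convex K0" "closed K0" "0 \<in> interior K0"
    unfolding K0_def interior_translation mem_translate
    using K closed_translation[of K "- z"] zi by (simp_all only: convex_translation diff_minus_eq_add add_0)
  have memK0: "x \<in> K0 \<longleftrightarrow> z + x \<in> K" for x
    unfolding K0_def mem_translate by (simp add: add.commute)
  have frK0: "x \<in> frontier K0 \<longleftrightarrow> z + x \<in> C" for x
    unfolding K0_def frontier_translation K(1) mem_translate by (simp add: add.commute)
  define g where "g t = p + t *\<^sub>R v - z" for t :: real
  \<comment> \<open>A ray from \<open>z\<close> inside \<open>K\<close> would make
    \<open>(t - 1) *\<^sub>R v - d\<close> a recession direction, and adding \<open>d\<close> also
    \<open>(t - 1) *\<^sub>R v\<close>. This prolongs the chord beyond \<open>q\<close> or
    \<open>p\<close>; for \<open>t = 1\<close>, both \<open>d\<close> and \<open>- d\<close> would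
    be recession directions at \<open>p\<close>.\<close>
  have gpos: "mgauge K0 (g t) > 0" for t
  proof (rule mgauge_pos[OF K0], rule ccontr)
    assume "\<not> (\<exists>s\<ge>0. s *\<^sub>R g t \<notin> K0)"
    then have ray: "z + s *\<^sub>R g t \<in> K" if "s \<ge> 0" for s
      using memK0 that by blast
    have gt: "g t = (t - 1) *\<^sub>R v - d" by (simp add: g_def z_def algebra_simps)
    have rec: "x + (t - 1) *\<^sub>R v \<in> K" if "x \<in> K" for x
      using d(2)[OF closed_convex_ray_recession[OF K(2,3) ray that, of 1], of 1] by (simp add: gt algebra_simps)
    show False
    proof (cases "t = 1")
      case True
      have "p + 1 *\<^sub>R (- d) \<in> K"
        using closed_convex_ray_recession[OF K(2,3) ray, of p 1] pq sub gt True by auto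
      moreover have "p + 1 *\<^sub>R d \<in> K" using d(2)[of p 1] pq sub by auto
      ultimately show False
        using strictly_convex_not_between[OF C K pq(1)] open_segment_on_line[of "-1" 0 1 d p] d(1) by auto
    next
      case False
      then consider "t > 1" | "t < 1" by linarith
      then show False
      proof cases
        case 1
        have "q + (t - 1) *\<^sub>R v \<in> K" using rec[of q] pq sub by blast
        moreover have "q + (t - 1) *\<^sub>R v = p + (2 + (t - 1)) *\<^sub>R v"
          unfolding v(2) scaleR_left_distrib[of 2] by simp
        ultimately have "p + (2 + (t - 1)) *\<^sub>R v \<in> K" by simp
        then show False using nb'[of 0 2 "2 + (t - 1)"] 1 pq sub v by auto
      next
        case 2
        have "p + (t - 1) *\<^sub>R v \<in> K" using rec[of p] pq sub by auto
        then show False using nb'[of "t - 1" 0 2] 2 pq sub v by auto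
      qed
    qed
  qed
  define h where "h t = z + (1 / mgauge K0 (g t)) *\<^sub>R g t" for t
  have hC: "h t \<in> C" for t
    using mgauge_normalize[OF K0 gpos] frK0 by (simp add: h_def)
  have "continuous_on {0..2} h"
  proof -
    have "continuous_on {0..2} (\<lambda>t. mgauge K0 (g t))"
      by (rule continuous_on_compose2[OF continuous_on_mgauge[OF K0, of UNIV]]) (auto simp: g_def intro!: continuous_intros)
    then show ?thesis
      unfolding h_def by (intro continuous_intros) (use gpos in \<open>auto simp: g_def less_imp_neq[symmetric] intro!: continuous_intros\<close>)
  qed
  then have conn: "connected (h ` {0..2})"
    by (rule connected_continuous_image) simp
  have h02: "h 0 = p" "h 2 = q"
  proof -
    have "mgauge K0 (g 0) = 1" "mgauge K0 (g 2) = 1"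
      using frK0[of "g 0"] frK0[of "g 2"] mgauge_frontier[OF K0] pq v by (auto simp: g_def)
    then show "h 0 = p" "h 2 = q" using v by (auto simp: h_def g_def)
  qed
  define K' where "K' = (+) (- v) ` K"
  have K': "x \<in> K' \<longleftrightarrow> x + v \<in> K" "x \<in> frontier K' \<longleftrightarrow> x + v \<in> C" for x
    unfolding K'_def frontier_translation K(1) mem_translate by simp_all
  have "p \<in> K'" using K' mid interior_subset by blast
  moreover have "q \<notin> K'"
  proof
    assume "q \<in> K'"
    moreover have "q + v = p + 3 *\<^sub>R v" by (simp add: v(2) vec_eq_iff)
    ultimately have "p + 3 *\<^sub>R v \<in> K" using K' by metis
    then show False using nb'[of 0 2 3] pq sub v by auto
  qed
  ultimately have "h ` {0..2} \<inter> frontier K' \<noteq> {}"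
    using h02 by (intro connected_Int_frontier[OF conn]) force+
  then obtain s where "s \<in> C" "s + v \<in> C" using hC K' by auto
  then show ?thesis using that v pq by metis
qed

text \<open>A common point \<open>w\<close> of the translates by 0, \<open>v\<close> and
  \<open>2 v\<close> would put the collinear points \<open>w\<close>, \<open>w - v\<close>,
  \<open>w - 2 v\<close> on the curve.\<close>

lemma unbounded_strictly_convex_not_helly_two:
  assumes C: "strictly_convex_curve C" and nb: "\<not> bounded C"
  shows "\<not> helly_property (translates C) 2"
proof
  assume H: "helly_property (translates C) 2"
  obtain v p s where v: "v \<noteq> 0" "p \<in> C" "p + 2 *\<^sub>R v \<in> C" "s \<in> C" "s + v \<in> C"
    using unbounded_strictly_convex_half_chord[OF assms] .
  obtain K where K: "C = frontier K" "convex K" "closed K"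
    using C convex_curve_frontier unfolding strictly_convex_curve_def by metis
  define T where "T i = (+) (i *\<^sub>R v) ` C" for i :: real
  have T: "x \<in> T i \<longleftrightarrow> x - i *\<^sub>R v \<in> C" for x i by (simp add: T_def mem_translate)
  define F where "F = {T 0, T 1, T 2}"
  have "p + 2 *\<^sub>R v \<in> T 0" "p + 2 *\<^sub>R v \<in> T 2" "s + v \<in> T 0" "s + v \<in> T 1" "s + 2 *\<^sub>R v \<in> T 1" "s + 2 *\<^sub>R v \<in> T 2"
    using v by (simp_all add: T algebra_simps scaleR_2)
  then have meet: "T 0 \<inter> T 1 \<noteq> {}" "T 0 \<inter> T 2 \<noteq> {}" "T 1 \<inter> T 2 \<noteq> {}" by blast+
  have pair: "A \<inter> B \<noteq> {}" if "A \<in> F" "B \<in> F" for A B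
    using that meet unfolding F_def by (auto simp: Int_commute)
  have "F \<subseteq> translates C" unfolding F_def T_def translates_def by blast
  moreover have "\<forall>G\<subseteq>F. finite G \<and> card G \<le> 2 \<longrightarrow> \<Inter>G \<noteq> {}"
  proof (intro allI impI)
    fix G assume G: "G \<subseteq> F" "finite G \<and> card G \<le> 2"
    then consider "card G = 0" | "card G = 1" | "card G = 2" by linarith
    then show "\<Inter>G \<noteq> {}"
    proof cases
      case 1 then show ?thesis using G by simp
    next
      case 2 then show ?thesis using G pair by (auto simp: card_1_singleton_iff)
    next
      case 3
      then obtain A B where "G = {A, B}" using card_2_iff by metis
      then show ?thesis using G pair by simp
    qed
  qed
  ultimately have "\<Inter>F \<noteq> {}" using H unfolding helly_property_def by blast
  then obtain w where "w \<in> T 0" "w \<in> T 1" "w \<in> T 2" unfolding F_def by blast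
  then have "w + 0 *\<^sub>R v \<in> C" "w + (-1) *\<^sub>R v \<in> C" "w + (-2) *\<^sub>R v \<in> C" by (simp_all add: T)
  then show False
    using strictly_convex_no_three_collinear[OF C K v(1), of 0 "-1" "-2" w] by simp
qed

section \<open>Three chords bisected by the centroid\<close>

lemma open_ae_empty:
  fixes U :: "'a::euclidean_space set"
  assumes "open U" "AE x in lborel. x \<notin> U"
  shows "U = {}"
proof (rule ccontr)
  assume "U \<noteq> {}"
  have "AE x in lebesgue. x \<notin> U"
    by (rule AE_completion[OF assms(2)])
  then obtain N where "negligible N" "{x. \<not> x \<notin> U} \<subseteq> N"
    unfolding eventually_ae_filter_negligible by blast
  then have "negligible U"
    by (metis Collect_mem_eq negligible_subset not_not)
  then show False
    using open_not_negligible[OF assms(1) \<open>U \<noteq> {}\<close>] by simp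
qed

lemma open_subset_closure_off_hyperplane:
  fixes n :: "'a::euclidean_space"
  assumes "open U" "n \<noteq> 0"
  shows "U \<subseteq> closure (U \<inter> {x. n \<bullet> x \<noteq> b})"
proof -
  have "closure {x. n \<bullet> x \<noteq> b} = - interior {x. n \<bullet> x = b}"
    by (simp add: closure_interior Collect_neg_eq)
  then have "closure {x. n \<bullet> x \<noteq> b} = UNIV"
    using assms(2) by simp
  then show ?thesis
    using open_Int_closure_subset[OF assms(1), of "{x. n \<bullet> x \<noteq> b}"] by simp
qed

lemma lborel_reflect: "lborel = distr lborel borel (\<lambda>x. t - x :: 'a::euclidean_space)"
proof -
  have "lborel = density (distr lborel borel (\<lambda>x. t + (-1) *\<^sub>R x)) (\<lambda>_. \<bar>-1::real\<bar> ^ DIM('a))"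
    by (rule lborel_affine) simp
  then show ?thesis
    by (simp add: density_1)
qed

text \<open>First moments about the centroid vanish. If reflection in \<open>c\<close> kept all of
  \<open>K\<close> on one side of a line through \<open>c\<close> inside \<open>K\<close>, the
  moments of the two sides could agree only for a centrally symmetric \<open>K\<close>.\<close>

lemma centroid_balance:
  fixes K :: "'a::euclidean_space set"
  assumes K: "convex K" "compact K" "interior K \<noteq> {}"
  obtains c where "c \<in> interior K"
    "\<And>n. n \<noteq> 0 \<Longrightarrow> (\<exists>w\<in>K. 2 *\<^sub>R c - w \<notin> K \<and> 0 < n \<bullet> (w - c)) \<or> (\<forall>w\<in>K. 2 *\<^sub>R c - w \<in> K)"
proof -
  define \<mu> where "\<mu> = measure lborel K"
  have fin: "emeasure lborel K < \<infinity>"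
    using K(2) emeasure_compact_finite by blast
  have borel: "K \<in> sets lborel" using K(2) borel_compact by simp
  have "\<mu> \<noteq> 0"
  proof
    assume "\<mu> = 0"
    then have "emeasure lborel K = 0"
      unfolding \<mu>_def using fin emeasure_eq_ennreal_measure[of lborel K] by simp
    then have "K \<in> null_sets lborel" using borel by (simp add: null_sets_def)
    then have "AE x in lborel. x \<notin> K" by (rule AE_not_in)
    then have "AE x in lborel. x \<notin> interior K"
      by (rule AE_mp) (use interior_subset[of K] in auto)
    then show False using open_ae_empty[OF open_interior] K(3) by blast
  qed
  define c where "c = (1 / \<mu>) *\<^sub>R (\<integral>x. indicator K x *\<^sub>R x \<partial>lborel)"
  define f where "f x = indicator K x *\<^sub>R (x - c)" for x
  have int_id: "integrable lborel (\<lambda>x. indicator K x *\<^sub>R x)"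
    by (rule borel_integrable_compact[OF K(2)]) (intro continuous_intros)
  have int_c: "integrable lborel (\<lambda>x. indicator K x *\<^sub>R c)"
    by (rule borel_integrable_compact[OF K(2)]) (intro continuous_intros)
  have f_eq: "f x = indicator K x *\<^sub>R x - indicator K x *\<^sub>R c" for x
    by (simp add: f_def scaleR_right_diff_distrib)
  have int_f: "integrable lborel f"
    unfolding f_eq[abs_def] using int_id int_c by (rule Bochner_Integration.integrable_diff)
  have "(\<integral>x. indicator K x *\<^sub>R c \<partial>lborel) = \<mu> *\<^sub>R c"
    using fin borel by (simp add: \<mu>_def)
  then have f0: "(\<integral>x. f x \<partial>lborel) = 0"
    unfolding f_eq[abs_def] using int_id int_c \<open>\<mu> \<noteq> 0\<close>
    by (simp add: c_def)
  have meas: "f \<in> borel_measurable borel" using int_f by (simp add: integrable_iff_bounded)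
  have int_f': "integrable lborel (\<lambda>x. f (2 *\<^sub>R c - x))"
    using int_f integrable_distr_eq[of "\<lambda>x. 2 *\<^sub>R c - x" lborel borel f] meas
    by (simp flip: lborel_reflect)
  have f0': "(\<integral>x. f (2 *\<^sub>R c - x) \<partial>lborel) = 0"
    using f0 integral_distr[of "\<lambda>x. 2 *\<^sub>R c - x" lborel borel f] meas
    by (simp flip: lborel_reflect)
  have dense: "interior K \<subseteq> closure (interior K \<inter> {x. n \<bullet> x \<noteq> b})" if "n \<noteq> 0" for n b
    using open_subset_closure_off_hyperplane[OF open_interior that] .
  \<comment> \<open>If \<open>c\<close> were not interior, a separating hyperplane would make
    \<open>n \<bullet> f\<close> nonnegative with integral 0, hence zero almost everywhere, and the
    interior of \<open>K\<close> would lie in a hyperplane.\<close>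
  have c: "c \<in> interior K"
  proof (rule ccontr)
    assume "c \<notin> interior K"
    then have "convex ((+) (- c) ` interior K)" "0 \<notin> (+) (- c) ` interior K"
      using K(1) by (auto simp: convex_translation convex_interior)
    then obtain n where n: "n \<noteq> 0" "\<forall>x\<in>(+) (- c) ` interior K. 0 \<le> n \<bullet> x"
      using separating_hyperplane_set_0 by blast
    have "interior K \<subseteq> {x. n \<bullet> c \<le> n \<bullet> x}"
      using n(2) by (auto simp: inner_diff_right)
    then have "closure (interior K) \<subseteq> {x. n \<bullet> c \<le> n \<bullet> x}"
      by (rule closure_minimal) (rule closed_halfspace_ge)
    then have le: "n \<bullet> c \<le> n \<bullet> x" if "x \<in> K" for x
      using that closure_subset[of K] convex_closure_interior[OF K(1,3)] by auto
    have "AE x in lborel. n \<bullet> f x = 0"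
    proof (subst integral_nonneg_eq_0_iff_AE[symmetric])
      show "integrable lborel (\<lambda>x. n \<bullet> f x)" using int_f by simp
      show "AE x in lborel. 0 \<le> n \<bullet> f x"
        using le by (auto simp: f_def indicator_def inner_diff_right)
      show "(\<integral>x. n \<bullet> f x \<partial>lborel) = 0" using int_f f0 by simp
    qed
    then have "AE x in lborel. x \<notin> interior K \<inter> {x. n \<bullet> x \<noteq> n \<bullet> c}"
      by (rule AE_mp) (use interior_subset[of K] in \<open>auto simp: f_def indicator_def inner_diff_right\<close>)
    moreover have "open (interior K \<inter> {x. n \<bullet> x \<noteq> n \<bullet> c})"
      by (intro open_Int open_interior open_Collect_neq continuous_intros)
    ultimately have "interior K \<inter> {x. n \<bullet> x \<noteq> n \<bullet> c} = {}"
      by (intro open_ae_empty)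
    then show False
      using dense[OF n(1), of "n \<bullet> c"] K(3) by simp
  qed
  have "\<forall>w\<in>K. 2 *\<^sub>R c - w \<in> K"
    if n: "n \<noteq> 0" and no: "\<And>w. w \<in> K \<Longrightarrow> 0 < n \<bullet> (w - c) \<Longrightarrow> 2 *\<^sub>R c - w \<in> K" for n
  proof -
    \<comment> \<open>Averaging over the reflection turns the vanishing moment into the integral of
      a function that \<open>no\<close> makes nonnegative on both sides of the hyperplane.\<close>
    define h where "h x = - (n \<bullet> f x) - n \<bullet> f (2 *\<^sub>R c - x)" for x
    have h: "h x = n \<bullet> (x - c) * (indicator K (2 *\<^sub>R c - x) - indicator K x)" for x
    proof -
      have "2 *\<^sub>R c - x - c = - (x - c)" by (simp add: scaleR_2)
      then have "f (2 *\<^sub>R c - x) = - (indicator K (2 *\<^sub>R c - x) *\<^sub>R (x - c))"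
        unfolding f_def by (metis scaleR_minus_right)
      then show ?thesis by (simp add: h_def f_def algebra_simps)
    qed
    have h_nonneg: "0 \<le> h x" for x
    proof -
      consider "n \<bullet> (x - c) = 0" | "0 < n \<bullet> (x - c)" | "n \<bullet> (x - c) < 0" by linarith
      then show ?thesis
      proof cases
        case 2
        then have "x \<in> K \<Longrightarrow> 2 *\<^sub>R c - x \<in> K" using no by blast
        then show ?thesis unfolding h using 2 by (auto simp: indicator_def)
      next
        case 3
        have "n \<bullet> (2 *\<^sub>R c - x - c) = - (n \<bullet> (x - c))"
          by (simp add: inner_diff_right)
        then have "2 *\<^sub>R c - x \<in> K \<Longrightarrow> 2 *\<^sub>R c - (2 *\<^sub>R c - x) \<in> K"
          using no[of "2 *\<^sub>R c - x"] 3 by linarith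
        then have "2 *\<^sub>R c - x \<in> K \<Longrightarrow> x \<in> K" by simp
        then show ?thesis unfolding h using 3 by (auto simp: indicator_def)
      qed (simp add: h)
    qed
    have "AE x in lborel. h x = 0"
    proof (subst integral_nonneg_eq_0_iff_AE[symmetric])
      show "integrable lborel h" unfolding h_def[abs_def] using int_f int_f' by simp
      show "(\<integral>x. h x \<partial>lborel) = 0" unfolding h_def[abs_def] using int_f int_f' f0 f0' by simp
    qed (use h_nonneg in auto)
    \<comment> \<open>The interior points off the hyperplane whose reflections leave
      \<open>K\<close> form an open null set, so there are none; density and closedness extend this
      to all of \<open>K\<close>.\<close>
    then have "AE x in lborel. x \<notin> interior K \<inter> {x. n \<bullet> x \<noteq> n \<bullet> c} \<inter> (\<lambda>x. 2 *\<^sub>R c - x) -` (- K)"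
      by (rule AE_mp) (use interior_subset[of K] in \<open>auto simp: h indicator_def inner_diff_right\<close>)
    moreover have "open (interior K \<inter> {x. n \<bullet> x \<noteq> n \<bullet> c} \<inter> (\<lambda>x. 2 *\<^sub>R c - x) -` (- K))"
      using K(2) by (intro open_Int open_interior open_Collect_neq open_vimage continuous_intros)
        (auto simp: compact_imp_closed)
    ultimately have e: "interior K \<inter> {x. n \<bullet> x \<noteq> n \<bullet> c} \<inter> (\<lambda>x. 2 *\<^sub>R c - x) -` (- K) = {}"
      by (intro open_ae_empty)
    have cl: "closed ((\<lambda>x. 2 *\<^sub>R c - x) -` K)"
      using K(2) by (intro closed_vimage continuous_intros) (auto simp: compact_imp_closed)
    have "closure (interior K \<inter> {x. n \<bullet> x \<noteq> n \<bullet> c}) \<subseteq> (\<lambda>x. 2 *\<^sub>R c - x) -` K"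
      by (rule closure_minimal[OF _ cl]) (use e in blast)
    then have "interior K \<subseteq> (\<lambda>x. 2 *\<^sub>R c - x) -` K"
      using dense[OF n] by blast
    then have "closure (interior K) \<subseteq> (\<lambda>x. 2 *\<^sub>R c - x) -` K"
      by (rule closure_minimal[OF _ cl])
    then show ?thesis
      using closure_subset[of K] convex_closure_interior[OF K(1,3)] by auto
  qed
  then show ?thesis using that[OF c] by blast
qed

section \<open>Sign changes of odd functions and bisected chords\<close>

lemma zero_on_segment:
  fixes g :: "'a::real_normed_vector \<Rightarrow> real"
  assumes "continuous_on UNIV g" "g x < 0" "0 < g y"
  obtains u where "0 < u" "u < 1" "g ((1 - u) *\<^sub>R x + u *\<^sub>R y) = 0"
proof -
  have "continuous_on {0..1} (\<lambda>u. g ((1 - u) *\<^sub>R x + u *\<^sub>R y))"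
    by (rule continuous_on_compose2[OF assms(1)]) (auto intro!: continuous_intros)
  then obtain u where u: "0 \<le> u" "u \<le> 1" "g ((1 - u) *\<^sub>R x + u *\<^sub>R y) = 0"
    using IVT'[of "\<lambda>u. g ((1 - u) *\<^sub>R x + u *\<^sub>R y)" 0 0 1] assms by auto
  moreover have "u \<noteq> 0" "u \<noteq> 1" using u assms by auto
  ultimately show ?thesis using that by (simp add: less_le)
qed

text \<open>Caratheodory's theorem in the plane; the three points may coincide.\<close>

lemma zero_in_hull_three:
  fixes A :: "(real^2) set"
  assumes "0 \<in> convex hull A"
  obtains a b c and r s t :: real where "a \<in> A" "b \<in> A" "c \<in> A" "0 \<le> r" "0 \<le> s" "0 \<le> t" "r + s + t = 1"
    "r *\<^sub>R a + s *\<^sub>R b + t *\<^sub>R c = 0"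
proof -
  obtain S where S: "finite S" "S \<subseteq> A" "card S \<le> 3" "0 \<in> convex hull S"
    using assms by (auto simp: caratheodory[of A])
  have "S \<noteq> {}" using S(4) by auto
  then have "card S \<noteq> 0" using S(1) by simp
  then have "card S = 1 \<or> card S = 2 \<or> card S = 3" using S(3) by linarith
  then obtain a b c where abc: "S = {a, b, c}"
    by (elim disjE) (auto simp: card_1_singleton_iff card_2_iff card_3_iff)
  then show ?thesis
    using S(2,4) that[of a b c] by (auto simp: convex_hull_3)
qed

text \<open>Around the origin the directions occur in the cyclic order \<open>w\<^sub>1, - w\<^sub>3, w\<^sub>2, - w\<^sub>1\<close>, and an odd
  function that is negative at each \<open>w\<^sub>i\<close> changes sign between any two consecutive ones.\<close>

lemma odd_homogeneous_three_zeros: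
  fixes g :: "real^2 \<Rightarrow> real"
  assumes cont: "continuous_on UNIV g" and hom: "\<And>k x. g (k *\<^sub>R x) = k * g x"
    and w: "g w1 < 0" "g w2 < 0" "g w3 < 0"
    and c: "0 \<le> c1" "0 \<le> c2" "0 \<le> c3" "c1 + c2 + c3 = 1" "c1 *\<^sub>R w1 + c2 *\<^sub>R w2 + c3 *\<^sub>R w3 = 0"
  obtains z1 z2 z3 where "g z1 = 0" "g z2 = 0" "g z3 = 0"
    "rot z1 \<bullet> z2 \<noteq> 0" "rot z1 \<bullet> z3 \<noteq> 0" "rot z2 \<bullet> z3 \<noteq> 0"
proof -
  have neg: "g (- x) = - g x" for x using hom[of "-1" x] by simp
  \<comment> \<open>Two points with negative values cannot balance at the origin, so none of the
    three weights vanishes.\<close>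
  have no2: False if "g a < 0" "g b < 0" "0 \<le> r" "0 \<le> s" "r + s = 1" "r *\<^sub>R a + s *\<^sub>R b = 0" for a b r s
  proof -
    have "r *\<^sub>R a = - (s *\<^sub>R b)" using that(6) by (simp add: eq_neg_iff_add_eq_0)
    then have e: "r * g a = - (s * g b)" using hom neg by metis
    have "r * g a \<le> 0" "s * g b \<le> 0"
      using that by (simp_all add: mult_nonneg_nonpos)
    then have "r * g a = 0" "s * g b = 0" using e by linarith+
    then show False using that by auto
  qed
  have c3: "c3 > 0"
  proof (rule ccontr)
    assume "\<not> c3 > 0"
    then have "c3 = 0" using c by simp
    then show False using no2[OF w(1,2) c(1,2)] c by simp
  qed
  have c1: "c1 > 0"
  proof (rule ccontr)
    assume "\<not> c1 > 0"
    then have "c1 = 0" using c by simp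
    then show False using no2[OF w(2,3) c(2,3)] c by simp
  qed
  have c2: "c2 > 0"
  proof (rule ccontr)
    assume "\<not> c2 > 0"
    then have "c2 = 0" using c by simp
    then show False using no2[OF w(1,3) c(1,3)] c by simp
  qed
  define s1 s2 where "s1 = c1 / c3" and "s2 = c2 / c3"
  have s: "s1 > 0" "s2 > 0" using c1 c2 c3 by (auto simp: s1_def s2_def)
  define u where "u = s1 *\<^sub>R w1 + s2 *\<^sub>R w2"
  have "c3 *\<^sub>R u = c3 *\<^sub>R (- w3)"
    using c(5) c3 by (simp add: u_def s1_def s2_def scaleR_right_distrib eq_neg_iff_add_eq_0)
  then have u3: "u = - w3" using c3 by (metis less_irrefl scaleR_left_imp_eq)
  define \<Delta> where "\<Delta> = rot w1 \<bullet> w2"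
  \<comment> \<open>If \<open>w1\<close> and \<open>w2\<close> were parallel, negativity of
    \<open>g\<close> at both would make them positive multiples of each other, and \<open>g\<close>
    would be negative at \<open>u = - w3\<close>.\<close>
  have "\<Delta> \<noteq> 0"
  proof
    assume "\<Delta> = 0"
    then have "rot w1 \<bullet> w1 = rot w1 \<bullet> w2" by (simp add: \<Delta>_def rot_inner_self)
    moreover have "w1 \<noteq> 0" using w(1) hom[of 0 0] by auto
    ultimately obtain t where "w2 = w1 + t *\<^sub>R w1" using rot_eq_on_line by blast
    then have w2: "w2 = (1 + t) *\<^sub>R w1" by (simp add: scaleR_left_distrib)
    then have gt: "g w2 = (1 + t) * g w1" by (simp only: hom)
    then have "1 + t > 0" using w by (smt (verit) mult_nonpos_nonpos)
    moreover have "u = (s1 + s2 * (1 + t)) *\<^sub>R w1" by (simp add: u_def w2 algebra_simps)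
    ultimately have "g u = (s1 + s2 * (1 + t)) * g w1" "s1 + s2 * (1 + t) > 0"
      using s by (simp_all only: hom add_pos_pos mult_pos_pos)
    then have "g u < 0" using w(1) by (simp add: mult_pos_neg)
    then show False using w(3) by (simp add: u3 neg)
  qed
  have gu: "g u > 0" using w(3) by (simp add: u3 neg)
  obtain a where a: "0 < a" "a < 1" "g ((1 - a) *\<^sub>R w1 + a *\<^sub>R u) = 0"
    using zero_on_segment[OF cont w(1) gu] .
  obtain b where b: "0 < b" "b < 1" "g ((1 - b) *\<^sub>R w2 + b *\<^sub>R u) = 0"
    using zero_on_segment[OF cont w(2) gu] .
  have "0 < g (- w1)" using w(1) by (simp add: neg)
  then obtain d where d: "0 < d" "d < 1" "g ((1 - d) *\<^sub>R w2 + d *\<^sub>R (- w1)) = 0"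
    using zero_on_segment[OF cont w(2)] by blast
  define z1 z2 z3 where "z1 = (1 - a) *\<^sub>R w1 + a *\<^sub>R u" and "z2 = (1 - b) *\<^sub>R w2 + b *\<^sub>R u"
    and "z3 = (1 - d) *\<^sub>R w2 + d *\<^sub>R (- w1)"
  \<comment> \<open>Each determinant is \<open>\<Delta>\<close> times a sum of positive terms, so
    the three zeros have pairwise independent directions.\<close>
  have "rot z1 \<bullet> z2 = ((1 - a) * (1 - b) + (1 - a) * b * s2 + a * (1 - b) * s1) * \<Delta>"
    by (simp add: z1_def z2_def u_def \<Delta>_def rot_inner algebra_simps)
  moreover have "rot z1 \<bullet> z3 = ((1 - a) * (1 - d) + a * s1 * (1 - d) + a * s2 * d) * \<Delta>"
    by (simp add: z1_def z3_def u_def \<Delta>_def rot_inner algebra_simps)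
  moreover have "rot z2 \<bullet> z3 = ((1 - b) * d + b * s1 * (1 - d) + b * s2 * d) * \<Delta>"
    by (simp add: z2_def z3_def u_def \<Delta>_def rot_inner algebra_simps)
  moreover have "(1 - a) * (1 - b) + (1 - a) * b * s2 + a * (1 - b) * s1 > 0"
    "(1 - a) * (1 - d) + a * s1 * (1 - d) + a * s2 * d > 0"
    "(1 - b) * d + b * s1 * (1 - d) + b * s2 * d > 0"
    using a b d s by (auto intro!: add_pos_pos mult_pos_pos)
  ultimately have "rot z1 \<bullet> z2 \<noteq> 0" "rot z1 \<bullet> z3 \<noteq> 0" "rot z2 \<bullet> z3 \<noteq> 0"
    using \<open>\<Delta> \<noteq> 0\<close> by auto
  then show ?thesis
    using that[of z1 z2 z3] a b d by (simp add: z1_def z2_def z3_def)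
qed

text \<open>The chord through 0 in direction \<open>z\<close> is bisected by 0 exactly when the odd
  function \<open>g\<close> vanishes at \<open>z\<close>. For symmetric \<open>K\<close> any three
  directions serve. Otherwise \<open>g\<close> is negative on the points of \<open>K\<close> whose
  reflections leave \<open>K\<close>, and the balance condition puts 0 in their convex hull.\<close>

lemma three_bisected_chords:
  fixes K :: "(real^2) set"
  assumes K: "convex K" "compact K" "0 \<in> interior K"
    and bal: "(\<forall>n. n \<noteq> 0 \<longrightarrow> (\<exists>w\<in>K. - w \<notin> K \<and> 0 < n \<bullet> w)) \<or> (\<forall>w\<in>K. - w \<in> K)"
  obtains m1 m2 m3 where "\<forall>m\<in>{m1, m2, m3}. m \<in> frontier K \<and> - m \<in> frontier K"
    "rot m1 \<bullet> m2 \<noteq> 0" "rot m1 \<bullet> m3 \<noteq> 0" "rot m2 \<bullet> m3 \<noteq> 0"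
proof -
  have K': "convex K" "closed K" "0 \<in> interior K"
    using K by (auto simp: compact_imp_closed)
  define G where "G = mgauge K"
  define g where "g x = G x - G (- x)" for x
  have Gscale: "G (k *\<^sub>R x) = k * G x" if "k \<ge> 0" for k x
    unfolding G_def by (rule mgauge_scale[OF K' that])
  have Gpos: "G x > 0" if "x \<noteq> 0" for x
    unfolding G_def
  proof (rule mgauge_pos[OF K'])
    obtain B where B: "\<And>y. y \<in> K \<Longrightarrow> norm y \<le> B" "B > 0"
      using compact_imp_bounded[OF K(2)] bounded_pos by metis
    have "norm (((B + 1) / norm x) *\<^sub>R x) = B + 1" using that B(2) by simp
    then have "((B + 1) / norm x) *\<^sub>R x \<notin> K" using B(1) by force
    moreover have "(B + 1) / norm x \<ge> 0" using B(2) by simp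
    ultimately show "\<exists>t\<ge>0. t *\<^sub>R x \<notin> K" by blast
  qed
  have "\<exists>z1 z2 z3. g z1 = 0 \<and> g z2 = 0 \<and> g z3 = 0 \<and> rot z1 \<bullet> z2 \<noteq> 0 \<and> rot z1 \<bullet> z3 \<noteq> 0 \<and> rot z2 \<bullet> z3 \<noteq> 0"
  proof (cases "\<forall>w\<in>K. - w \<in> K")
    case True
    have le: "G (- x) \<le> G x" if "x \<noteq> 0" for x
    proof -
      have "(1 / G x) *\<^sub>R x \<in> K"
        using mgauge_le_iff[OF K' Gpos[OF that], of x] by (simp add: G_def)
      then have "(1 / G x) *\<^sub>R (- x) \<in> K" using True by fastforce
      then show ?thesis
        using mgauge_le_iff[OF K' Gpos[OF that], of "- x"] by (simp add: G_def)
    qed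
    have "g x = 0" for x
      using le[of x] le[of "- x"] by (cases "x = 0") (auto simp: g_def)
    then show ?thesis
      by (intro exI[of _ "vector [1, 0]"] exI[of _ "vector [0, 1]"] exI[of _ "vector [1, 1]"])
         (simp add: rot_inner)
  next
    case False
    define A where "A = {w \<in> K. - w \<notin> K}"
    have gneg: "g w < 0" if "w \<in> A" for w
    proof -
      have "G w \<le> 1" "\<not> G (- w) \<le> 1"
        using that mgauge_le_iff[OF K', of 1 w] mgauge_le_iff[OF K', of 1 "- w"] by (auto simp: A_def G_def)
      then show ?thesis by (simp add: g_def)
    qed
    have "0 \<in> convex hull A"
    proof (rule ccontr)
      assume "0 \<notin> convex hull A"
      then obtain n where n: "n \<noteq> 0" "\<forall>x\<in>convex hull A. 0 \<le> n \<bullet> x"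
        using separating_hyperplane_set_0[OF convex_convex_hull] by blast
      obtain w where "w \<in> K" "- w \<notin> K" "0 < (- n) \<bullet> w"
        using bal False n(1) by (metis neg_equal_0_iff_equal)
      then show False using n(2) hull_inc[of w A] by (force simp: A_def)
    qed
    then obtain w1 w2 w3 c1 c2 c3 where w: "w1 \<in> A" "w2 \<in> A" "w3 \<in> A"
      and c: "0 \<le> c1" "0 \<le> c2" "0 \<le> c3" "c1 + c2 + c3 = 1" "c1 *\<^sub>R w1 + c2 *\<^sub>R w2 + c3 *\<^sub>R w3 = 0"
      by (rule zero_in_hull_three)
    have "continuous_on UNIV (\<lambda>x. G (- x))"
      unfolding G_def by (rule continuous_on_compose2[OF continuous_on_mgauge[OF K', of UNIV]]) (auto intro!: continuous_intros)
    then have cont: "continuous_on UNIV g"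
      unfolding g_def using continuous_on_mgauge[OF K', of UNIV] by (intro continuous_intros) (auto simp: G_def)
    have hom: "g (k *\<^sub>R x) = k * g x" for k x
    proof (cases "k \<ge> 0")
      case True
      have "G (- (k *\<^sub>R x)) = k * G (- x)" using Gscale[OF True, of "- x"] by simp
      then show ?thesis using Gscale[OF True, of x] by (simp add: g_def right_diff_distrib)
    next
      case False
      then have k: "- k \<ge> 0" by simp
      have "G (k *\<^sub>R x) = - k * G (- x)" "G (- (k *\<^sub>R x)) = - k * G x"
        using Gscale[OF k, of "- x"] Gscale[OF k, of x] by simp_all
      then show ?thesis by (simp add: g_def algebra_simps)
    qed
    show ?thesis
      using odd_homogeneous_three_zeros[OF cont hom gneg[OF w(1)] gneg[OF w(2)] gneg[OF w(3)] c] by metis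
  qed
  then obtain z1 z2 z3 where z: "g z1 = 0" "g z2 = 0" "g z3 = 0"
    and r: "rot z1 \<bullet> z2 \<noteq> 0" "rot z1 \<bullet> z3 \<noteq> 0" "rot z2 \<bullet> z3 \<noteq> 0" by blast
  have z0: "z1 \<noteq> 0" "z2 \<noteq> 0" "z3 \<noteq> 0" using r by (auto simp: rot_inner)
  define m where "m z = (1 / G z) *\<^sub>R z" for z
  have m: "m z \<in> frontier K \<and> - m z \<in> frontier K" if "g z = 0" "z \<noteq> 0" for z
  proof -
    have "G (- z) = G z" using that by (simp add: g_def)
    then show ?thesis
      using mgauge_normalize[OF K', of z] mgauge_normalize[OF K', of "- z"] Gpos[OF that(2)]
      by (simp add: m_def G_def)
  qed
  have rm: "rot (m x) \<bullet> m y = (1 / (G x * G y)) * (rot x \<bullet> y)" for x y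
    by (simp add: m_def rot_inner right_diff_distrib mult.commute)
  show ?thesis
  proof (rule that[of "m z1" "m z2" "m z3"])
    show "\<forall>x\<in>{m z1, m z2, m z3}. x \<in> frontier K \<and> - x \<in> frontier K"
      using m z z0 by blast
  qed (use r Gpos[OF z0(1)] Gpos[OF z0(2)] Gpos[OF z0(3)] in \<open>simp_all add: rm\<close>)
qed

section \<open>Bounded strictly convex curves\<close>

text \<open>The complement of a large ball is connected and avoids the frontier, so an unbounded
  \<open>K\<close> contains all of it. Every point is then a midpoint of two points of
  \<open>K\<close>, and \<open>K\<close> is the whole space.\<close>

lemma bounded_frontier_imp_bounded:
  fixes K :: "'a::euclidean_space set"
  assumes "convex K" "K \<noteq> UNIV" "bounded (frontier K)" "2 \<le> DIM('a)"
  shows "bounded K"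
proof (rule ccontr)
  assume nb: "\<not> bounded K"
  obtain B where B: "frontier K \<subseteq> ball 0 B" "B > 0"
    using bounded_subset_ballD[OF assms(3)] by blast
  have "connected (- ball (0::'a) B)"
    using assms(4) by (intro connected_complement_bounded_convex) auto
  moreover have "- ball 0 B \<inter> K \<noteq> {}"
    using nb bounded_subset[OF bounded_ball, of K 0 B] by blast
  ultimately have out: "- ball 0 B \<subseteq> K"
    using connected_Int_frontier[of "- ball 0 B" K] B by blast
  have "x \<in> K" for x
  proof -
    obtain e :: 'a where e: "norm e = B + norm x"
      using vector_choose_size[of "B + norm x"] B(2) by auto
    have "x + e \<in> K" "x - e \<in> K"
      using out norm_triangle_ineq2[of e "- x"] norm_triangle_ineq2[of e x] e
      by (auto simp: subset_iff add.commute norm_minus_commute)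
    then have "(1/2) *\<^sub>R (x + e) + (1/2) *\<^sub>R (x - e) \<in> K"
      using assms(1) by (intro convexD) auto
    then show ?thesis by (simp add: algebra_simps flip: scaleR_left_distrib)
  qed
  then show False using assms(2) by blast
qed

lemma bounded_strictly_convex_bisected_chords:
  assumes C: "strictly_convex_curve C" "bounded C" and pq: "p \<in> C" "q \<in> C" "p \<noteq> q"
  obtains m1 m2 m3 c where "\<forall>m\<in>{m1, m2, m3}. c + m \<in> C \<and> c - m \<in> C"
    "rot m1 \<bullet> m2 \<noteq> 0" "rot m1 \<bullet> m3 \<noteq> 0" "rot m2 \<bullet> m3 \<noteq> 0"
proof -
  obtain K where K: "convex K" "closed K" "K \<noteq> UNIV" "C = frontier K"
    using C(1) convex_curve_frontier unfolding strictly_convex_curve_def by metis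
  have comp: "compact K"
    using bounded_frontier_imp_bounded[OF K(1,3)] C(2) K(2,4) by (simp add: compact_eq_bounded_closed)
  have int: "interior K \<noteq> {}"
  proof
    assume "interior K = {}"
    then have "C = K" using K by (simp add: frontier_def)
    then show False using strictly_convex_subset[OF C(1), of K p q] K(1) pq by auto
  qed
  obtain c where c: "c \<in> interior K"
    "\<And>n. n \<noteq> 0 \<Longrightarrow> (\<exists>w\<in>K. 2 *\<^sub>R c - w \<notin> K \<and> 0 < n \<bullet> (w - c)) \<or> (\<forall>w\<in>K. 2 *\<^sub>R c - w \<in> K)"
    using centroid_balance[OF K(1) comp int] by blast
  define K0 where "K0 = (+) (- c) ` K"
  have mem: "x \<in> K0 \<longleftrightarrow> c + x \<in> K" "x \<in> interior K0 \<longleftrightarrow> c + x \<in> interior K" "x \<in> frontier K0 \<longleftrightarrow> c + x \<in> C" for x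
    unfolding K0_def interior_translation frontier_translation mem_translate K(4) by (simp_all add: add.commute)
  have refl: "- (w - c) \<in> K0 \<longleftrightarrow> 2 *\<^sub>R c - w \<in> K" for w
    unfolding mem by (simp add: scaleR_2 algebra_simps)
  have "convex K0" "compact K0"
    using K(1) comp compact_translation[OF comp, of "- c"] unfolding K0_def by (auto simp: convex_translation)
  moreover have "0 \<in> interior K0" using c(1) mem by simp
  moreover have "(\<forall>n. n \<noteq> 0 \<longrightarrow> (\<exists>w\<in>K0. - w \<notin> K0 \<and> 0 < n \<bullet> w)) \<or> (\<forall>w\<in>K0. - w \<in> K0)"
  proof (cases "\<forall>w\<in>K. 2 *\<^sub>R c - w \<in> K")
    case True
    have "- w \<in> K0" if "w \<in> K0" for w
      using True refl[of "c + w"] that mem(1) by simp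
    then show ?thesis by blast
  next
    case False
    have "\<exists>w\<in>K0. - w \<notin> K0 \<and> 0 < n \<bullet> w" if n: "n \<noteq> 0" for n
    proof -
      obtain w where w: "w \<in> K" "2 *\<^sub>R c - w \<notin> K" "0 < n \<bullet> (w - c)"
        using c(2)[OF n] False by blast
      have "w - c \<in> K0" using w(1) mem(1) by simp
      then show ?thesis using w refl by blast
    qed
    then show ?thesis by blast
  qed
  ultimately obtain m1 m2 m3 where m: "\<forall>m\<in>{m1, m2, m3}. m \<in> frontier K0 \<and> - m \<in> frontier K0"
    "rot m1 \<bullet> m2 \<noteq> 0" "rot m1 \<bullet> m3 \<noteq> 0" "rot m2 \<bullet> m3 \<noteq> 0"
    by (rule three_bisected_chords)
  have "\<forall>m\<in>{m1, m2, m3}. c + m \<in> C \<and> c - m \<in> C"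
    using m(1) mem(3) by force
  then show ?thesis using that[of m1 m2 m3 c] m by blast
qed

text \<open>A curve equal to a proper translate of itself would consist entirely of ends of chords
  given by one vector, hence of at most two points.\<close>

lemma translate_inject:
  assumes C: "strictly_convex_curve C" and S: "S \<subseteq> C" "card S = 3"
    and eq: "(+) a ` C = (+) b ` C"
  shows "a = b"
proof (rule ccontr)
  assume "a \<noteq> b"
  then obtain p q where pq: "{x \<in> C. x - (b - a) \<in> C} \<subseteq> {p, q}"
    using strictly_convex_two_points[OF C, of "b - a"] by auto
  have "x - (b - a) \<in> C" if "x \<in> C" for x
    using that eq mem_translate[of "x + a" a C] mem_translate[of "x + a" b C] by (simp add: algebra_simps)
  then have "S \<subseteq> {p, q}" using pq S(1) by blast
  then have "card S \<le> card {p, q}" by (rule card_mono[rotated]) simp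
  moreover have "card {p, q} \<le> 2" by (simp add: card_insert_if)
  ultimately show False using S(2) by simp
qed

text \<open>The sums of two of the four centres are \<open>\<pm> m\<^sub>1, \<pm> m\<^sub>2, \<pm> m\<^sub>3\<close>, so the reflections of the centres
  in \<open>c / 2\<close> are the common points of the triples, as for an orthocentric system and the unit circle.\<close>

lemma bounded_strictly_convex_four_translates:
  assumes C: "strictly_convex_curve C" "bounded C" and pq: "p \<in> C" "q \<in> C" "p \<noteq> q"
  obtains F where "F \<subseteq> translates C" "card F = 4" "\<And>G. G \<subseteq> F \<Longrightarrow> card G = 3 \<Longrightarrow> \<Inter>G \<noteq> {}" "\<Inter>F = {}"
proof -
  obtain m1 m2 m3 c where m: "\<forall>m\<in>{m1, m2, m3}. c + m \<in> C \<and> c - m \<in> C"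
    and r: "rot m1 \<bullet> m2 \<noteq> 0" "rot m1 \<bullet> m3 \<noteq> 0" "rot m2 \<bullet> m3 \<noteq> 0"
    by (rule bounded_strictly_convex_bisected_chords[OF assms])
  have ne: "m1 \<noteq> m2" "m1 \<noteq> m3" "m2 \<noteq> m3" "m1 + m2 \<noteq> 0" "m1 + m3 \<noteq> 0" "m2 + m3 \<noteq> 0"
    using r by (auto simp: rot_inner eq_neg_iff_add_eq_0[symmetric])
  define S where "S = {c + m1, c + m2, c + m3}"
  have S: "S \<subseteq> C" "card S = 3" using m ne by (auto simp: S_def)
  define T where "T x = (+) ((1/2) *\<^sub>R x) ` C" for x :: "real^2"
  define x1 x2 x3 x4 where "x1 = m1 + m2 + m3" and "x2 = m1 - m2 - m3" and "x3 = m2 - m1 - m3" and "x4 = m3 - m1 - m2"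
  note xs = x1_def x2_def x3_def x4_def
  have Tinj: "x = y" if "T x = T y" for x y
    using translate_inject[OF C(1) S, of "(1/2) *\<^sub>R x" "(1/2) *\<^sub>R y"] that by (simp add: T_def)
  have diff: "(1/2) *\<^sub>R (x1 - x2) = m2 + m3" "(1/2) *\<^sub>R (x1 - x3) = m1 + m3" "(1/2) *\<^sub>R (x1 - x4) = m1 + m2"
    "(1/2) *\<^sub>R (x2 - x3) = m1 - m2" "(1/2) *\<^sub>R (x2 - x4) = m1 - m3" "(1/2) *\<^sub>R (x3 - x4) = m2 - m3"
    by (simp_all add: xs vec_eq_iff field_simps)
  have x: "distinct [x1, x2, x3, x4]"
    using diff ne by auto
  have half_sum: "(1/2) *\<^sub>R (x1 + x2) = m1" "(1/2) *\<^sub>R (x1 + x3) = m2" "(1/2) *\<^sub>R (x1 + x4) = m3"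
    "(1/2) *\<^sub>R (x2 + x3) = - m3" "(1/2) *\<^sub>R (x2 + x4) = - m2" "(1/2) *\<^sub>R (x3 + x4) = - m1"
    by (simp_all add: xs vec_eq_iff field_simps)
  define P where "P y = c - (1/2) *\<^sub>R y" for y
  define Q where "Q = {x1, x2, x3, x4}"
  have PT: "P y \<in> T x \<longleftrightarrow> c - (1/2) *\<^sub>R (x + y) \<in> C" for x y
    unfolding T_def mem_translate P_def by (simp add: scaleR_right_distrib algebra_simps)
  \<comment> \<open>Thus \<open>P y\<close> lies on all the translates except possibly
    \<open>T y\<close>, and omitting \<open>y\<close> gives the common point of the other
    three.\<close>
  have on: "P y \<in> T x" if "x \<in> Q" "y \<in> Q" "x \<noteq> y" for x y
  proof -
    have "c - (1/2) *\<^sub>R (x1 + x2) \<in> C" "c - (1/2) *\<^sub>R (x1 + x3) \<in> C" "c - (1/2) *\<^sub>R (x1 + x4) \<in> C"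
      "c - (1/2) *\<^sub>R (x2 + x3) \<in> C" "c - (1/2) *\<^sub>R (x2 + x4) \<in> C" "c - (1/2) *\<^sub>R (x3 + x4) \<in> C"
      unfolding half_sum using m by simp_all
    then show ?thesis
      unfolding PT using that by (auto simp: Q_def add.commute)
  qed
  define F where "F = T ` Q"
  have Tinj': "inj_on T Q" using Tinj by (auto simp: inj_on_def)
  have "card Q = 4" using x by (simp add: Q_def)
  then have cF: "card F = 4" unfolding F_def by (simp add: card_image[OF Tinj'])
  show ?thesis
  proof (rule that[of F])
    show "F \<subseteq> translates C"
      unfolding F_def T_def translates_def by blast
    show "\<Inter>G \<noteq> {}" if G: "G \<subseteq> F" "card G = 3" for G
    proof -
      have "\<not> F \<subseteq> G"
      proof
        assume "F \<subseteq> G"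
        then have "F = G" using G(1) by blast
        then show False using G(2) cF by simp
      qed
      then obtain y where y: "y \<in> Q" "T y \<notin> G" unfolding F_def by blast
      have "P y \<in> X" if X: "X \<in> G" for X
      proof -
        obtain x where "x \<in> Q" "X = T x" using X G(1) unfolding F_def by blast
        then show ?thesis using on[of x y] y X by blast
      qed
      then show ?thesis by blast
    qed
    show "\<Inter>F = {}"
    proof (rule ccontr)
      assume "\<Inter>F \<noteq> {}"
      then obtain w where w: "w \<in> T x" if "x \<in> Q" for x unfolding F_def by blast
      \<comment> \<open>A point common to all four would be the unique point of every triple, hence
        equal to both \<open>P x4\<close> and \<open>P x3\<close>.\<close>
      have eq: "w = P y" if "a \<in> Q" "b \<in> Q" "d \<in> Q" "y \<in> Q" "distinct [a, b, d, y]" for a b d y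
      proof (rule three_translates_one_point[OF C(1), of "T a" "T b" "T d"])
        show "T a \<noteq> T b" "T a \<noteq> T d" "T b \<noteq> T d" using that(5) Tinj by auto
        show "P y \<in> T a" "P y \<in> T b" "P y \<in> T d" using on that by auto
      qed (use w that in \<open>auto simp: T_def translates_def\<close>)
      have "w = P x4" "w = P x3"
        using eq[of x1 x2 x3 x4] eq[of x1 x2 x4 x3] x by (auto simp: Q_def)
      then show False using x by (auto simp: P_def)
    qed
  qed (rule cF)
qed

section \<open>From the counting results to Helly numbers\<close>

lemma helly_number_le: "helly_property \<F> n \<Longrightarrow> helly_number \<F> \<le> enat n"
  unfolding helly_number_def by (rule Inf_lower) blast

lemma finite_helly_number_le: "finite_helly_property \<F> n \<Longrightarrow> finite_helly_number \<F> \<le> enat n"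
  unfolding finite_helly_number_def by (rule Inf_lower) blast

lemma helly_property_mono: "helly_property \<F> m \<Longrightarrow> m \<le> n \<Longrightarrow> helly_property \<F> n"
  unfolding helly_property_def by (meson order_trans)

lemma helly_number_eq:
  assumes "helly_property \<F> (Suc n)" "\<not> helly_property \<F> n"
  shows "helly_number \<F> = enat (Suc n)"
proof (rule antisym)
  show "enat (Suc n) \<le> helly_number \<F>"
    unfolding helly_number_def
  proof (rule Inf_greatest, clarify)
    fix k assume "helly_property \<F> k"
    then show "enat (Suc n) \<le> enat k"
      using helly_property_mono[of \<F> k n] assms(2) by (cases "k \<le> n") auto
  qed
qed (rule helly_number_le[OF assms(1)])

text \<open>For infinite families the bound 6 needs compact pieces, hence no ray on the curve, or
  else translation invariance along a line contained in it. The sharpness of 5 is stated for curves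
  with two distinct points: a one-point curve already satisfies \<open>triples_suffice C 3\<close>,
  since three distinct translates never meet.\<close>

theorem theorem2:
  fixes C :: "(real^2) set"
  assumes "convex_curve C"
  shows "(finite_helly_number (translates C) \<le> 6 \<and>
          ((contains_ray C \<longrightarrow> contains_line C) \<longrightarrow> helly_number (translates C) \<le> 6)) \<and>
         (strictly_convex_curve C \<longrightarrow> helly_number (translates C) \<le> 4) \<and>
         (strictly_convex_curve C \<longrightarrow> triples_suffice C 5) \<and>
         (strictly_convex_curve C \<and> bounded C \<and> (\<exists>p\<in>C. \<exists>q\<in>C. p \<noteq> q) \<longrightarrow>
           (\<forall>k<5. \<not> triples_suffice C k)) \<and>
         (strictly_convex_curve C \<and> \<not> bounded C \<longrightarrow> helly_number (translates C) = 3)"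
proof -
  obtain K where K: "convex K" "closed K" "C = frontier K"
    using convex_curve_frontier[OF assms] by metis
  have six: "\<exists>G\<subseteq>F. finite G \<and> card G \<le> 6 \<and> \<Inter>G = {}"
    if F: "F \<subseteq> translates C" "\<Inter>F = {}" "finite F \<or> (contains_ray C \<longrightarrow> contains_line C)" for F
  proof -
    have "frontier_translates K F"
      using F(1) unfolding K(3) translates_frontier_translates .
    then have "misses F UNIV 6"
      using misses_translates[OF _ F(2) K(1,2)] F(3) unfolding K(3) by simp
    then show ?thesis unfolding misses_def by simp
  qed
  have "finite_helly_property (translates C) 6"
    unfolding finite_helly_property_def
  proof (intro allI impI notI)
    fix F assume F: "F \<subseteq> translates C" "finite F" "\<Inter>F = {}"
      and G: "\<forall>G\<subseteq>F. card G \<le> 6 \<longrightarrow> \<Inter>G \<noteq> {}"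
    show False using six[OF F(1,3)] F(2) G by metis
  qed
  then have 1: "finite_helly_number (translates C) \<le> 6"
    using finite_helly_number_le by (metis numeral_eq_enat)
  have 2: "helly_number (translates C) \<le> 6" if "contains_ray C \<longrightarrow> contains_line C"
  proof -
    have "helly_property (translates C) 6"
      unfolding helly_property_def
    proof (intro allI impI notI)
      fix F assume F: "F \<subseteq> translates C" "\<Inter>F = {}"
        and G: "\<forall>G\<subseteq>F. finite G \<and> card G \<le> 6 \<longrightarrow> \<Inter>G \<noteq> {}"
      show False using six[OF F] that G by metis
    qed
    then show ?thesis using helly_number_le by (metis numeral_eq_enat)
  qed
  have 3: "helly_number (translates C) \<le> 4" if "strictly_convex_curve C"
    using helly_number_le[OF strictly_convex_helly_four[OF that]] by (simp add: numeral_eq_enat)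
  have 4: "\<not> triples_suffice C k"
    if C: "strictly_convex_curve C" "bounded C" "p \<in> C" "q \<in> C" "p \<noteq> q" and k: "k < 5" for p q k
  proof -
    obtain F where "F \<subseteq> translates C" "card F = 4" "\<And>G. G \<subseteq> F \<Longrightarrow> card G = 3 \<Longrightarrow> \<Inter>G \<noteq> {}" "\<Inter>F = {}"
      using bounded_strictly_convex_four_translates[OF C] by blast
    moreover have "k \<le> 4" using k by simp
    ultimately show ?thesis
      unfolding triples_suffice_def by (intro notI) (elim allE[of _ F], simp)
  qed
  have 5: "helly_number (translates C) = 3" if "strictly_convex_curve C" "\<not> bounded C"
    using helly_number_eq[of "translates C" 2] unbounded_strictly_convex_helly_three[OF that]
      unbounded_strictly_convex_not_helly_two[OF that] by (simp add: numeral_eq_enat)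
  show ?thesis
    using 1 2 3 4 5 strictly_convex_triples_suffice by blast
qed

end
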